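(* Let $V=(J,(V_j)_{j\in J},d,H)$ be a hypergraph system and let $(\nu_e)_{e\in H}$ be a pseudorandom system of measures on $V$. Let $e\in H$ and let $f_e:V_e\to[0,\infty)$ satisfy $0\le f_e(x_e)\le\nu_e(x_e)$ for all $x_e\in V_e$. Let $0<\varepsilon<1$ be sufficiently small, and assume $N$ is sufficiently large depending on $\varepsilon$. Then there exist a $\sigma$-algebra $\mathcal{B}_e$ on $V_e$ and a set $\Omega_e\in\mathcal{B}_e$ such that $$\mathbb{E}\big(1_{\Omega_e}(x_e)\nu_e(x_e)\mid x_e\in V_e\big)=o_{N\to\infty;\varepsilon}(1),$$ $$\mathbb{E}(\nu_e\mid\mathcal{B}_e)(x_e)=1+o_{N\to\infty;\varepsilon}(1)\quad\text{for all }x_e\in V_e\setminus\Omega_e,$$ and $$\big\|(1-1_{\Omega_e})\big(f_e-\mathbb{E}(f_e\mid\mathcal{B}_e)\big)\big\|_{\Box^e}\le\varepsilon^{1/2^{|J|}}.$$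
   Context: A hypergraph system is a quadruple $V=(J,(V_j)_{j\in J},d,H)$ where $J$ is a finite set, each $V_j$ is a finite nonempty set, $d\ge1$ is an integer and $H\subseteq\binom{J}{d}:=\{e\subseteq J:|e|=d\}$; for $e\subseteq J$ put $V_e:=\prod_{j\in e}V_j$. For a $\sigma$-algebra $\mathcal{B}$ on the finite set $V_e$ and $f:V_e\to\mathbb{R}$, $\mathbb{E}(f\mid\mathcal{B})(x)$ is the average of $f$ (uniform measure) over the atom of $\mathcal{B}$ containing $x$. For a finite nonempty set $Z$ and $f:Z\to\mathbb{R}$, $\mathbb{E}(f(x)\mid x\in Z):=|Z|^{-1}\sum_{x\in Z}f(x)$; constraints written after the bar mean uniform averaging over all tuples satisfying them. All objects depend on a parameter $N$ ranging over a sequence tending to infinity while $J,d,H$ are fixed; implicit constants may depend on $J$. $o_{x\to0;y}(X)$ denotes a quantity bounded in magnitude by $c(x,y)X$ where $c(x,y)\to0$ as $x\to0$ for each fixed $y$; $O_y(X)$ a quantity bounded by $C(y)X$. Cube notation: for a finite set $e$, $\{0,1\}^e$ is the set of tuples $\omega=(\omega_j)_{j\in e}$ with $\omega_j\in\{0,1\}$, and $0^e$ is the all-zero tuple; for $x^{(0)}_J,x^{(1)}_J\in V_J$, $e\subseteq J$ and $\omega\in\{0,1\}^e$, set $x^{(\omega)}_e:=(x^{(\omega_j)}_j)_{j\in e}\in V_e$ and $x^{(a)}_e:=(x^{(a)}_j)_{j\in e}$ for $a\in\{0,1\}$. The Gowers cube norm of $f:V_e\to\mathbb{R}$ is $\|f\|_{\Box^e}:=\mathbb{E}\big(\prod_{\omega\in\{0,1\}^e}f(x^{(\omega)}_e)\mid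 x^{(0)}_e,x^{(1)}_e\in V_e\big)^{1/2^{|e|}}$. A system of measures is a family of functions $\nu_e:V_e\to[0,\infty)$, $e\in H$, with $\mathbb{E}(\nu_e(x_e)\mid x_e\in V_e)=1+o_{N\to\infty}(1)$. For $e\in H$ and $f:V_e\to\mathbb{R}$, $\mathcal{D}_ef(x^{(0)}_e):=\mathbb{E}\big(\prod_{\omega\in\{0,1\}^e,\ \omega\neq 0^e}f(x^{(\omega)}_e)\mid x^{(1)}_e\in V_e\big)$. The system is pseudorandom if: (i) $\mathcal{D}_e(\nu_e+1)(x_e)=O(1)$ for all $e\in H$, $x_e\in V_e$; (ii) for every choice of exponents $n_{e,\omega}\in\{0,1\}$, $\mathbb{E}\big(\prod_{e\in H}\prod_{\omega\in\{0,1\}^e}\nu_e(x^{(\omega)}_e)^{n_{e,\omega}}\mid x^{(0)}_J,x^{(1)}_J\in V_J\big)=1+o_{N\to\infty}(1)$; (iii) for every $e\in H$, $j\in e$, every choice of $n_{e,\omega}\in\{0,1\}$ and every integer $K\ge0$, $\mathbb{E}\Big(\mathbb{E}\big(\prod_{\omega\in\{0,1\}^e}\nu_e(x^{(\omega)}_e)^{n_{e,\omega}}\mid x^{(0)}_j,x^{(1)}_j\in V_j\big)^K\ \Big|\ x^{(0)}_{e\setminus\{j\}},x^{(1)}_{e\setminus\{j\}}\in V_{e\setminus\{j\}}\Big)=O_K(1)$. *)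

theory Defs
  imports "HOL-Analysis.Analysis"
begin

text \<open>Hypergraph systems indexed by the asymptotic parameter N :: nat.
  Index type 'j, vertex-element type 'a. V N j is the finite set V_j at stage N.
  Points of V_e are functions in PiE e (V N) (extensional, undefined outside e).\<close>

definition avg :: "'b set \<Rightarrow> ('b \<Rightarrow> real) \<Rightarrow> real" where
  "avg A g = (\<Sum>x\<in>A. g x) / real (card A)"

definition VE :: "('j \<Rightarrow> 'a set) \<Rightarrow> 'j set \<Rightarrow> ('j \<Rightarrow> 'a) set" where
  "VE W e = PiE e W"

definition cubes :: "'j set \<Rightarrow> ('j \<Rightarrow> bool) set" where
  "cubes e = PiE e (\<lambda>_. UNIV)"

definition zero_cube :: "'j set \<Rightarrow> ('j \<Rightarrow> bool)" where
  "zero_cube e = restrict (\<lambda>_. False) e"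

definition cpt :: "'j set \<Rightarrow> ('j \<Rightarrow> 'a) \<Rightarrow> ('j \<Rightarrow> 'a) \<Rightarrow> ('j \<Rightarrow> bool) \<Rightarrow> ('j \<Rightarrow> 'a)" where
  "cpt e x0 x1 \<omega> = restrict (\<lambda>j. if \<omega> j then x1 j else x0 j) e"

definition box_norm :: "('j \<Rightarrow> 'a set) \<Rightarrow> 'j set \<Rightarrow> (('j \<Rightarrow> 'a) \<Rightarrow> real) \<Rightarrow> real" where
  "box_norm W e g =
     avg (VE W e \<times> VE W e) (\<lambda>(x0, x1). \<Prod>\<omega>\<in>cubes e. g (cpt e x0 x1 \<omega>))
       powr (1 / 2 ^ card e)"

definition Dop :: "('j \<Rightarrow> 'a set) \<Rightarrow> 'j set \<Rightarrow> (('j \<Rightarrow> 'a) \<Rightarrow> real) \<Rightarrow> ('j \<Rightarrow> 'a) \<Rightarrow> real" where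
  "Dop W e g x0 = avg (VE W e) (\<lambda>x1. \<Prod>\<omega>\<in>cubes e - {zero_cube e}. g (cpt e x0 x1 \<omega>))"

definition atom :: "'b set \<Rightarrow> 'b set set \<Rightarrow> 'b \<Rightarrow> 'b set" where
  "atom S B x = {y \<in> S. \<forall>A\<in>B. x \<in> A \<longrightarrow> y \<in> A}"

definition cond_exp :: "'b set \<Rightarrow> 'b set set \<Rightarrow> ('b \<Rightarrow> real) \<Rightarrow> 'b \<Rightarrow> real" where
  "cond_exp S B f x = avg (atom S B x) f"

definition hypergraph_system :: "'j set \<Rightarrow> (nat \<Rightarrow> 'j \<Rightarrow> 'a set) \<Rightarrow> nat \<Rightarrow> 'j set set \<Rightarrow> bool" where
  "hypergraph_system J V d H \<longleftrightarrow>
     finite J \<and> (\<forall>N. \<forall>j\<in>J. finite (V N j) \<and> V N j \<noteq> {}) \<and> d \<ge> 1 \<and>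
     H \<subseteq> {e. e \<subseteq> J \<and> card e = d}"

definition system_of_measures ::
  "(nat \<Rightarrow> 'j \<Rightarrow> 'a set) \<Rightarrow> 'j set set \<Rightarrow> (nat \<Rightarrow> 'j set \<Rightarrow> ('j \<Rightarrow> 'a) \<Rightarrow> real) \<Rightarrow> bool" where
  "system_of_measures V H \<nu> \<longleftrightarrow>
     (\<forall>e\<in>H. (\<forall>N. \<forall>x\<in>VE (V N) e. \<nu> N e x \<ge> 0) \<and>
             (\<lambda>N. avg (VE (V N) e) (\<nu> N e)) \<longlonglongrightarrow> 1)"

definition pseudorandom ::
  "'j set \<Rightarrow> (nat \<Rightarrow> 'j \<Rightarrow> 'a set) \<Rightarrow> 'j set set \<Rightarrow> (nat \<Rightarrow> 'j set \<Rightarrow> ('j \<Rightarrow> 'a) \<Rightarrow> real) \<Rightarrow> bool" where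
  "pseudorandom J V H \<nu> \<longleftrightarrow>
     (\<forall>e\<in>H. \<exists>C. \<forall>N. \<forall>x\<in>VE (V N) e. \<bar>Dop (V N) e (\<lambda>y. \<nu> N e y + 1) x\<bar> \<le> C) \<and>
     (\<forall>n :: 'j set \<Rightarrow> ('j \<Rightarrow> bool) \<Rightarrow> bool.
        (\<lambda>N. avg (VE (V N) J \<times> VE (V N) J)
           (\<lambda>(x0, x1). \<Prod>e\<in>H. \<Prod>\<omega>\<in>cubes e.
               (if n e \<omega> then \<nu> N e (cpt e x0 x1 \<omega>) else 1))) \<longlonglongrightarrow> 1) \<and>
     (\<forall>e\<in>H. \<forall>j\<in>e. \<forall>n :: ('j \<Rightarrow> bool) \<Rightarrow> bool. \<forall>K :: nat. \<exists>C. \<forall>N.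
        \<bar>avg (VE (V N) (e - {j}) \<times> VE (V N) (e - {j}))
           (\<lambda>(x0, x1). (avg (V N j \<times> V N j)
              (\<lambda>(y0, y1). \<Prod>\<omega>\<in>cubes e.
                 (if n \<omega> then \<nu> N e (cpt e (x0(j := y0)) (x1(j := y1)) \<omega>) else 1))) ^ K)\<bar> \<le> C)"

end

(*
  The dual functions D_e F with |F| <= nu + 1 are bounded, and finite products of them are asymptotically
  orthogonal to nu - 1: applying Cauchy-Schwarz once per coordinate of e bounds the correlation of any f with such
  a product by a power of the box integral of f, where the discarded factors are controlled by condition (iii), and
  condition (ii) makes the box integral of nu - 1 tend to 0. By Weierstrass approximation, nu - 1 is then almost
  orthogonal to level sets of dual functions, provided the thresholds are shifted so that little mass of nu + 1
  lies near them; hence E(nu | B) is close to 1 off a small set Omega for every partition B into such level sets.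
  If F = (1 - 1_Omega)(f - E(f | B)) has a large box norm, it correlates with its own dual function, and refining B by
  the level sets of that function increases the energy of E(f | B) by a fixed amount, which can happen only
  boundedly often.
*)
theory Submission
  imports Defs
begin

section \<open>Averages\<close>

text \<open>The obstacle is that \<nu> is unbounded, so E(f | B) has no a priori L2 bound. Off
  \<Omega>, however, E(f | B) \<le> E(\<nu> | B) \<le> 2, and the energy is therefore truncated to
  the complement of \<Omega>. As \<Omega> changes with B, the truncated energy is not monotone under
  refinement: the loss is controlled by the measure and the \<nu>-mass of the new \<Omega>, and the
  orthogonality tolerance is chosen so small that the loss is at most half of the gain. The same
  bound 2 gives |F| \<le> 2(\<nu> + 1), which is why dual functions are taken of functions bounded
  by \<nu> + 1. Since f varies arbitrarily with N, the asymptotic statements are uniform: for all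
  large N, for all lists of dual functions. The order of choices is: \<epsilon> and a fixed
  tolerance \<delta>, the maximal number of dual functions, the number T of threshold shifts, and
  last how large N must be. A diagonal choice of \<delta> depending on N finally turns fixed
  tolerances into o(1).\<close>

lemma avg_add: "avg X (\<lambda>x. f x + g x) = avg X f + avg X g"
  by (simp add: avg_def sum.distrib add_divide_distrib)

lemma avg_diff: "avg X (\<lambda>x. f x - g x) = avg X f - avg X g"
  by (simp add: avg_def sum_subtractf diff_divide_distrib)

lemma avg_cmult: "avg X (\<lambda>x. c * f x) = c * avg X f"
  by (simp add: avg_def sum_distrib_left)

lemma avg_cmult_right: "avg X (\<lambda>x. f x * c) = avg X f * c"
  by (simp add: avg_def sum_distrib_right)

lemma avg_sum: "avg X (\<lambda>x. \<Sum>i\<in>I. f i x) = (\<Sum>i\<in>I. avg X (f i))"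
  by (simp add: avg_def sum.swap[of _ X] sum_divide_distrib)

lemma avg_cong: "(\<And>x. x \<in> X \<Longrightarrow> f x = g x) \<Longrightarrow> avg X f = avg X g"
  by (simp add: avg_def)

lemma avg_mono: "(\<And>x. x \<in> X \<Longrightarrow> f x \<le> g x) \<Longrightarrow> avg X f \<le> avg X g"
  by (simp add: avg_def divide_right_mono sum_mono)

lemma avg_nonneg: "(\<And>x. x \<in> X \<Longrightarrow> 0 \<le> f x) \<Longrightarrow> 0 \<le> avg X f"
  by (simp add: avg_def sum_nonneg)

lemma avg_const: "finite X \<Longrightarrow> X \<noteq> {} \<Longrightarrow> avg X (\<lambda>_. c) = c"
  by (simp add: avg_def)

lemma avg_abs_le: "\<bar>avg X f\<bar> \<le> avg X (\<lambda>x. \<bar>f x\<bar>)"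
  by (simp add: avg_def abs_divide divide_right_mono)

lemma avg_abs_mono: "(\<And>x. x \<in> X \<Longrightarrow> \<bar>f x\<bar> \<le> g x) \<Longrightarrow> \<bar>avg X f\<bar> \<le> avg X g"
  by (rule order_trans[OF avg_abs_le avg_mono])

lemma avg_swap: "avg X (\<lambda>x. avg Y (f x)) = avg Y (\<lambda>y. avg X (\<lambda>x. f x y))"
  by (simp add: avg_def sum_divide_distrib[symmetric] sum.swap[of _ Y] mult.commute)

lemma avg_Times: "avg (X \<times> Y) (\<lambda>(x, y). f x y) = avg X (\<lambda>x. avg Y (f x))"
  by (simp add: avg_def sum.cartesian_product[symmetric] sum_divide_distrib[symmetric]
      card_cartesian_product mult.commute)

lemma avg_Cauchy_Schwarz: "(avg X (\<lambda>x. f x * g x))\<^sup>2 \<le> avg X (\<lambda>x. (f x)\<^sup>2) * avg X (\<lambda>x. (g x)\<^sup>2)"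
proof -
  have "(\<Sum>x\<in>X. f x * g x)\<^sup>2 \<le> (\<Sum>x\<in>X. (f x)\<^sup>2) * (\<Sum>x\<in>X. (g x)\<^sup>2)"
    by (rule Cauchy_Schwarz_ineq_sum)
  then show ?thesis
    by (simp add: avg_def power_divide power2_eq_square divide_right_mono)
qed

lemma avg_Times': "avg (X \<times> Y) f = avg X (\<lambda>x. avg Y (\<lambda>y. f (x, y)))"
  using avg_Times[of X Y "\<lambda>x y. f (x, y)"] by simp

section \<open>Partitions and energy\<close>

text \<open>A \<sigma>-algebra on a finite set is handled through a labelling \<phi> whose fibres
  are its atoms. Refinement then reads
  \<open>\<psi> x = \<psi> y \<Longrightarrow> \<phi> x = \<phi> y\<close>, and measurability is
  invariance under equal labels.\<close>

definition saturated_sets :: "'b set \<Rightarrow> ('b \<Rightarrow> 'c) \<Rightarrow> 'b set set" where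
  "saturated_sets X \<phi> = {U. U \<subseteq> X \<and> (\<forall>x\<in>U. \<forall>y\<in>X. \<phi> x = \<phi> y \<longrightarrow> y \<in> U)}"

lemma sigma_algebra_saturated_sets: "sigma_algebra X (saturated_sets X \<phi>)"
  unfolding sigma_algebra_iff2
proof (intro conjI ballI allI impI)
  show "saturated_sets X \<phi> \<subseteq> Pow X" "{} \<in> saturated_sets X \<phi>"
    by (auto simp: saturated_sets_def)
next
  fix U assume "U \<in> saturated_sets X \<phi>"
  then show "X - U \<in> saturated_sets X \<phi>"
    unfolding saturated_sets_def by (simp, metis Diff_iff)
next
  fix A :: "nat \<Rightarrow> 'a set" assume A: "range A \<subseteq> saturated_sets X \<phi>"
  then have "A i \<in> saturated_sets X \<phi>" for i by auto
  then show "(\<Union>i. A i) \<in> saturated_sets X \<phi>"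
    unfolding saturated_sets_def by blast
qed

lemma atom_saturated_sets:
  assumes "x \<in> X" shows "atom X (saturated_sets X \<phi>) x = {y \<in> X. \<phi> y = \<phi> x}"
proof -
  have "{y \<in> X. \<phi> y = \<phi> x} \<in> saturated_sets X \<phi>" by (auto simp: saturated_sets_def)
  then have "\<phi> y = \<phi> x" if "y \<in> atom X (saturated_sets X \<phi>) x" for y
    using that assms bspec[of "saturated_sets X \<phi>" "\<lambda>A. x \<in> A \<longrightarrow> y \<in> A" "{y \<in> X. \<phi> y = \<phi> x}"]
    by (simp add: atom_def)
  moreover have "y \<in> atom X (saturated_sets X \<phi>) x" if "y \<in> X" "\<phi> y = \<phi> x" for y
    using that unfolding atom_def saturated_sets_def by simp
  ultimately show ?thesis by (auto simp: atom_def)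
qed

definition class_avg :: "'b set \<Rightarrow> ('b \<Rightarrow> 'c) \<Rightarrow> ('b \<Rightarrow> real) \<Rightarrow> 'b \<Rightarrow> real" where
  "class_avg X \<phi> f x = avg {y \<in> X. \<phi> y = \<phi> x} f"

lemma cond_exp_saturated_sets:
  "x \<in> X \<Longrightarrow> cond_exp X (saturated_sets X \<phi>) f x = class_avg X \<phi> f x"
  by (simp add: cond_exp_def class_avg_def atom_saturated_sets)

text \<open>Written as a double sum over pairs of points with equal labels, the left side allows the
  two points to be exchanged, because \<open>g\<close> and the class size agree on both; the sum
  over one of them is then trivial.\<close>

lemma avg_class_avg:
  assumes "finite X" and g: "\<And>x y. x \<in> X \<Longrightarrow> y \<in> X \<Longrightarrow> \<phi> x = \<phi> y \<Longrightarrow> g x = g y"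
  shows "avg X (\<lambda>x. class_avg X \<phi> f x * g x) = avg X (\<lambda>x. f x * g x)"
proof -
  let ?c = "\<lambda>x. real (card {y \<in> X. \<phi> y = \<phi> x})"
  have "(\<Sum>x\<in>X. class_avg X \<phi> f x * g x)
      = (\<Sum>x\<in>X. \<Sum>y\<in>X. if \<phi> y = \<phi> x then f y * g x / ?c x else 0)"
    by (intro sum.cong refl)
      (simp add: class_avg_def avg_def sum_divide_distrib sum_distrib_right assms(1)
        flip: sum.inter_filter)
  also have "\<dots> = (\<Sum>x\<in>X. \<Sum>y\<in>X. if \<phi> x = \<phi> y then f y * g y / ?c y else 0)"
    by (intro sum.cong refl) (auto dest: g)
  also have "\<dots> = (\<Sum>y\<in>X. \<Sum>x\<in>X. if \<phi> x = \<phi> y then f y * g y / ?c y else 0)"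
    by (rule sum.swap)
  also have "\<dots> = (\<Sum>y\<in>X. f y * g y)"
  proof (intro sum.cong refl)
    fix y assume y: "y \<in> X"
    then have "{x \<in> X. \<phi> x = \<phi> y} \<noteq> {}" by auto
    then have "?c y \<noteq> 0" using assms(1) by simp
    then show "(\<Sum>x\<in>X. if \<phi> x = \<phi> y then f y * g y / ?c y else 0) = f y * g y"
      by (simp add: assms(1) flip: sum.inter_filter)
  qed
  finally show ?thesis by (simp add: avg_def)
qed

section \<open>Exceptional sets and the energy increment\<close>

definition bad_set :: "'b set \<Rightarrow> ('b \<Rightarrow> 'c) \<Rightarrow> ('b \<Rightarrow> real) \<Rightarrow> real \<Rightarrow> 'b set" where
  "bad_set X \<phi> \<nu> \<delta> = {x \<in> X. \<bar>class_avg X \<phi> \<nu> x - 1\<bar> > \<delta>}"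

lemma class_avg_cong: "\<phi> x = \<phi> y \<Longrightarrow> class_avg X \<phi> f x = class_avg X \<phi> f y"
  by (simp add: class_avg_def)

lemma class_avg_nonneg: "(\<And>x. x \<in> X \<Longrightarrow> 0 \<le> f x) \<Longrightarrow> 0 \<le> class_avg X \<phi> f x"
  by (auto simp: class_avg_def intro: avg_nonneg)

lemma class_avg_mono: "(\<And>x. x \<in> X \<Longrightarrow> f x \<le> g x) \<Longrightarrow> class_avg X \<phi> f x \<le> class_avg X \<phi> g x"
  by (auto simp: class_avg_def intro: avg_mono)

lemma bad_set_saturated: "bad_set X \<phi> \<nu> \<delta> \<in> saturated_sets X \<phi>"
  by (auto simp: bad_set_def saturated_sets_def class_avg_def)

text \<open>Markov's inequality for class averages: as \<open>U\<close> is a union of classes,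
  \<open>\<nu> - 1\<close> has the same average over \<open>U\<close> as its class averages, which
  on \<open>U\<close> all have the sign \<open>s\<close> and size at least
  \<open>\<delta>\<close>.\<close>

lemma avg_indicator_le:
  fixes s :: real and \<nu> :: "'b \<Rightarrow> real"
  assumes "finite X" "X \<noteq> {}" "0 < \<delta>" "U \<in> saturated_sets X \<phi>" "\<bar>s\<bar> = 1"
    and orth: "\<bar>avg X (\<lambda>x. indicator U x * (\<nu> x - 1))\<bar> \<le> \<tau>"
    and U: "\<And>x. x \<in> U \<Longrightarrow> \<delta> \<le> s * (class_avg X \<phi> \<nu> x - 1)"
  shows "avg X (indicator U) \<le> \<tau> / \<delta>"
proof -
  have inv: "indicator U x = (indicator U y :: real)" if "x \<in> X" "y \<in> X" "\<phi> x = \<phi> y" for x y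
    using that assms(4) by (auto simp: indicator_def saturated_sets_def)
  have "\<delta> * avg X (indicator U) = avg X (\<lambda>x. \<delta> * indicator U x)" by (simp add: avg_cmult)
  also have "\<dots> \<le> avg X (\<lambda>x. s * (class_avg X \<phi> \<nu> x * indicator U x - indicator U x))"
    by (rule avg_mono) (use U in \<open>auto simp: indicator_def\<close>)
  also have "\<dots> = s * (avg X (\<lambda>x. \<nu> x * indicator U x) - avg X (indicator U))"
    using avg_class_avg[where \<phi>=\<phi> and f=\<nu>, OF assms(1) inv] by (simp add: avg_cmult avg_diff)
  also have "\<dots> = s * avg X (\<lambda>x. indicator U x * (\<nu> x - 1))"
    by (simp add: avg_diff[symmetric] algebra_simps)
  also have "\<dots> \<le> \<bar>s * avg X (\<lambda>x. indicator U x * (\<nu> x - 1))\<bar>" by simp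
  also have "\<dots> \<le> \<tau>" using orth assms(5) by (simp add: abs_mult)
  finally show ?thesis using assms(3) by (simp add: field_simps)
qed

text \<open>The bad set splits into an excess part and a deficit part, each a union of classes of
  small measure. It is itself a union of classes, so passing from its measure to its \<nu>-mass
  costs only another \<open>\<tau>\<close>.\<close>

lemma avg_bad_set:
  assumes "finite X" "X \<noteq> {}" "0 < \<delta>"
    and orth: "\<And>U. U \<in> saturated_sets X \<phi> \<Longrightarrow> \<bar>avg X (\<lambda>x. indicator U x * (\<nu> x - 1))\<bar> \<le> \<tau>"
  shows "avg X (indicator (bad_set X \<phi> \<nu> \<delta>)) \<le> 2 * \<tau> / \<delta>"
    and "avg X (\<lambda>x. indicator (bad_set X \<phi> \<nu> \<delta>) x * \<nu> x) \<le> 2 * \<tau> / \<delta> + \<tau>"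
proof -
  define P where "P = {x \<in> X. class_avg X \<phi> \<nu> x - 1 > \<delta>}"
  define M where "M = {x \<in> X. class_avg X \<phi> \<nu> x - 1 < - \<delta>}"
  have sat: "P \<in> saturated_sets X \<phi>" "M \<in> saturated_sets X \<phi>"
    by (auto simp: P_def M_def saturated_sets_def class_avg_def)
  have 1: "avg X (indicator P) \<le> \<tau> / \<delta>"
    by (rule avg_indicator_le[where s=1, OF assms(1-3) sat(1) _ orth[OF sat(1)]]) (auto simp: P_def)
  have 2: "avg X (indicator M) \<le> \<tau> / \<delta>"
    by (rule avg_indicator_le[where s="-1", OF assms(1-3) sat(2) _ orth[OF sat(2)]]) (auto simp: M_def)
  have "avg X (indicator (bad_set X \<phi> \<nu> \<delta>)) \<le> avg X (\<lambda>x. indicator P x + indicator M x)"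
    by (rule avg_mono) (auto simp: indicator_def bad_set_def P_def M_def)
  then show 3: "avg X (indicator (bad_set X \<phi> \<nu> \<delta>)) \<le> 2 * \<tau> / \<delta>" using 1 2 by (simp add: avg_add)
  have "avg X (\<lambda>x. indicator (bad_set X \<phi> \<nu> \<delta>) x * (\<nu> x - 1)) \<le> \<tau>"
    using orth[OF bad_set_saturated, of \<nu> \<delta>] by simp
  moreover have "avg X (\<lambda>x. indicator (bad_set X \<phi> \<nu> \<delta>) x * (\<nu> x - 1))
      = avg X (\<lambda>x. indicator (bad_set X \<phi> \<nu> \<delta>) x * \<nu> x) - avg X (indicator (bad_set X \<phi> \<nu> \<delta>))"
    by (simp only: avg_diff[symmetric]) (intro avg_cong, simp add: algebra_simps)
  ultimately show "avg X (\<lambda>x. indicator (bad_set X \<phi> \<nu> \<delta>) x * \<nu> x) \<le> 2 * \<tau> / \<delta> + \<tau>" using 3 by linarith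
qed

text \<open>The squared L2 norm of E(f | B), cut off where E(\<nu> | B) is far from 1; the cut-off
  makes it bounded independently of N.\<close>

definition energy :: "'b set \<Rightarrow> ('b \<Rightarrow> 'c) \<Rightarrow> ('b \<Rightarrow> real) \<Rightarrow> real \<Rightarrow> ('b \<Rightarrow> real) \<Rightarrow> real" where
  "energy X \<phi> \<nu> \<delta> f = avg X (\<lambda>x. (1 - indicator (bad_set X \<phi> \<nu> \<delta>) x) * (class_avg X \<phi> f x)\<^sup>2)"

definition residual :: "'b set \<Rightarrow> ('b \<Rightarrow> 'c) \<Rightarrow> ('b \<Rightarrow> real) \<Rightarrow> real \<Rightarrow> ('b \<Rightarrow> real) \<Rightarrow> 'b \<Rightarrow> real" where
  "residual X \<phi> \<nu> \<delta> f x = (1 - indicator (bad_set X \<phi> \<nu> \<delta>) x) * (f x - class_avg X \<phi> f x)"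

lemma class_avg_le_2:
  assumes "\<And>x. x \<in> X \<Longrightarrow> f x \<le> \<nu> x" "x \<in> X - bad_set X \<phi> \<nu> \<delta>" "\<delta> \<le> 1"
  shows "class_avg X \<phi> f x \<le> 2"
  using class_avg_mono[of X f \<nu> \<phi> x, OF assms(1)] assms by (auto simp: bad_set_def)

lemma energy_le:
  assumes "finite X" "X \<noteq> {}" "\<And>x. x \<in> X \<Longrightarrow> 0 \<le> f x" "\<And>x. x \<in> X \<Longrightarrow> f x \<le> \<nu> x" "\<delta> \<le> 1"
  shows "energy X \<phi> \<nu> \<delta> f \<le> 4"
proof -
  have "energy X \<phi> \<nu> \<delta> f \<le> avg X (\<lambda>_. 4)" unfolding energy_def
  proof (rule avg_mono)
    fix x assume x: "x \<in> X"
    show "(1 - indicator (bad_set X \<phi> \<nu> \<delta>) x) * (class_avg X \<phi> f x)\<^sup>2 \<le> 4"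
      using class_avg_le_2[of X f \<nu> x \<phi> \<delta>] class_avg_nonneg[of X f \<phi> x] assms(3-5) x
        power_mono[of "class_avg X \<phi> f x" 2 2]
      by (cases "x \<in> bad_set X \<phi> \<nu> \<delta>") auto
  qed
  then show ?thesis using assms(1,2) by (simp add: avg_const)
qed

text \<open>\<open>\<phi>\<close> is the old partition, \<open>\<psi>\<close> the refined one, and
  \<open>G'\<close> a discretized \<open>G\<close> that is constant on the new classes. Testing
  against \<open>G'\<close> does not distinguish \<open>f\<close> from its new conditional
  expectation, so the difference of the two conditional expectations correlates with
  \<open>G'\<close>; Cauchy-Schwarz makes it large in L2, and Pythagoras turns this into energy. The
  new bad set spoils both steps and is paid for with multiples of \<open>\<rho>\<close>.\<close>

lemma energy_increment:
  fixes \<phi> :: "'b \<Rightarrow> 'c" and \<psi> :: "'b \<Rightarrow> 'd"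
  assumes X: "finite X" "X \<noteq> {}" and f0: "\<And>x. x \<in> X \<Longrightarrow> 0 \<le> f x" and f\<nu>: "\<And>x. x \<in> X \<Longrightarrow> f x \<le> \<nu> x"
    and \<delta>: "\<delta> \<le> 1" and refine: "\<And>x y. \<psi> x = \<psi> y \<Longrightarrow> \<phi> x = \<phi> y"
    and \<rho>1: "avg X (indicator (bad_set X \<psi> \<nu> \<delta>)) \<le> \<rho>"
    and \<rho>2: "avg X (\<lambda>x. indicator (bad_set X \<psi> \<nu> \<delta>) x * \<nu> x) \<le> \<rho>"
    and \<nu>2: "avg X \<nu> \<le> 2" and C: "0 \<le> C" and G: "\<And>x. x \<in> X \<Longrightarrow> \<bar>G x\<bar> \<le> C"
    and G': "\<And>x y. x \<in> X \<Longrightarrow> y \<in> X \<Longrightarrow> \<psi> x = \<psi> y \<Longrightarrow> G' x = G' y"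
    and GG': "\<And>x. x \<in> X \<Longrightarrow> \<bar>G x - G' x\<bar> \<le> \<epsilon> / 8" and \<epsilon>: "0 < \<epsilon>" "\<epsilon> \<le> 1"
    and corr: "\<epsilon> < \<bar>avg X (\<lambda>x. residual X \<phi> \<nu> \<delta> f x * G x)\<bar>"
    and \<rho>: "\<rho> \<le> \<epsilon> / (12 * (C + 1))" "\<rho> \<le> \<epsilon>\<^sup>2 / (512 * (C + 1)\<^sup>2)"
  shows "energy X \<phi> \<nu> \<delta> f + \<epsilon>\<^sup>2 / (32 * (C + 1)\<^sup>2) \<le> energy X \<psi> \<nu> \<delta> f"
proof -
  define a where "a = class_avg X \<phi> f"
  define b where "b = class_avg X \<psi> f"
  define p :: "'b \<Rightarrow> real" where "p x = 1 - indicator (bad_set X \<phi> \<nu> \<delta>) x" for x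
  define q :: "'b \<Rightarrow> real" where "q x = indicator (bad_set X \<psi> \<nu> \<delta>) x" for x
  have a0: "0 \<le> a x" and b0: "0 \<le> b x" for x
    unfolding a_def b_def using f0 by (auto intro: class_avg_nonneg)
  have p01: "p x = 0 \<or> p x = 1" and q01: "q x = 0 \<or> q x = 1" for x
    by (auto simp: p_def q_def indicator_def)
  have pa: "p x * a x \<le> 2" if "x \<in> X" for x
    using class_avg_le_2[of X f \<nu> x \<phi> \<delta>] f\<nu> \<delta> that by (auto simp: a_def p_def indicator_def)
  have p_inv: "p x = p y" if "x \<in> X" "y \<in> X" "\<phi> x = \<phi> y" for x y
    using that bad_set_saturated[of X \<phi> \<nu> \<delta>] by (auto simp: p_def indicator_def saturated_sets_def)
  have q_inv: "q x = q y" if "x \<in> X" "y \<in> X" "\<psi> x = \<psi> y" for x y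
    using that bad_set_saturated[of X \<psi> \<nu> \<delta>] by (auto simp: q_def indicator_def saturated_sets_def)
  have a_inv: "a x = a y" if "\<phi> x = \<phi> y" for x y
    using that by (auto simp: a_def intro: class_avg_cong)
  have projb: "avg X (\<lambda>x. b x * g x) = avg X (\<lambda>x. f x * g x)"
    if "\<And>x y. x \<in> X \<Longrightarrow> y \<in> X \<Longrightarrow> \<psi> x = \<psi> y \<Longrightarrow> g x = g y" for g
    unfolding b_def by (rule avg_class_avg[OF X(1)]) (use that in blast)
  have proja: "avg X (\<lambda>x. a x * g x) = avg X (\<lambda>x. f x * g x)"
    if "\<And>x y. x \<in> X \<Longrightarrow> y \<in> X \<Longrightarrow> \<phi> x = \<phi> y \<Longrightarrow> g x = g y" for g
    unfolding a_def by (rule avg_class_avg[OF X(1)]) (use that in blast)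
  \<comment> \<open>On the new bad set the old \<open>p x * a x\<close> is at most 2, while the
    unbounded \<open>b\<close> is first exchanged for \<open>f \<le> \<nu>\<close> by
    projection.\<close>
  have qbound: "avg X (\<lambda>x. q x * (b x + p x * a x)) \<le> 3 * \<rho>"
  proof -
    have "avg X (\<lambda>x. q x * (b x + p x * a x)) \<le> avg X (\<lambda>x. b x * q x + 2 * q x)"
    proof (rule avg_mono)
      fix x assume "x \<in> X"
      then show "q x * (b x + p x * a x) \<le> b x * q x + 2 * q x"
        using pa[of x] q01[of x] by auto
    qed
    also have "\<dots> = avg X (\<lambda>x. f x * q x) + 2 * avg X q"
      by (simp only: avg_add avg_cmult projb[of q, OF q_inv])
    also have "avg X (\<lambda>x. f x * q x) \<le> avg X (\<lambda>x. q x * \<nu> x)"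
    proof (rule avg_mono)
      fix x assume "x \<in> X"
      then show "f x * q x \<le> q x * \<nu> x" using f\<nu>[of x] q01[of x] by auto
    qed
    also have "\<dots> \<le> \<rho>" using \<rho>2 by (simp add: q_def)
    finally show ?thesis using \<rho>1 by (simp add: q_def[abs_def])
  qed
  have 1: "\<bar>avg X (\<lambda>x. p x * (f x - a x) * (G x - G' x))\<bar> \<le> \<epsilon> / 2"
  proof -
    have "\<bar>avg X (\<lambda>x. p x * (f x - a x) * (G x - G' x))\<bar> \<le> avg X (\<lambda>x. (\<nu> x + a x * 1) * (\<epsilon>/8))"
    proof (rule avg_abs_mono)
      fix x assume x: "x \<in> X"
      have "\<bar>p x * (f x - a x)\<bar> \<le> \<nu> x + a x * 1"
        using p01[of x] f0[OF x] f\<nu>[OF x] a0[of x] by auto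
      then show "\<bar>p x * (f x - a x) * (G x - G' x)\<bar> \<le> (\<nu> x + a x * 1) * (\<epsilon>/8)"
        unfolding abs_mult[of _ "G x - G' x"] using GG'[OF x] by (intro mult_mono) auto
    qed
    also have "\<dots> = (avg X \<nu> + avg X f) * (\<epsilon>/8)"
      using proja[of "\<lambda>_. 1"] by (simp only: avg_add avg_cmult_right mult_1_right)
    also have "\<dots> \<le> (2 + 2) * (\<epsilon>/8)"
      by (rule mult_right_mono) (use avg_mono[of X f \<nu>] f\<nu> \<nu>2 \<epsilon> in auto)
    finally show ?thesis by simp
  qed
  have pinv': "p x * h x = p y * h y" if "x \<in> X" "y \<in> X" "\<psi> x = \<psi> y" "h x = h y" for h :: "'b \<Rightarrow> real" and x y
    using that p_inv refine by metis
  have corr': "\<epsilon> < \<bar>avg X (\<lambda>x. p x * (f x - a x) * G x)\<bar>"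
    using corr by (simp add: residual_def p_def a_def)
  have "avg X (\<lambda>x. p x * (f x - a x) * G x) =
      avg X (\<lambda>x. p x * (f x - a x) * (G x - G' x)) + avg X (\<lambda>x. p x * (f x - a x) * G' x)"
    by (simp only: avg_add[symmetric]) (intro avg_cong, simp add: algebra_simps)
  moreover have "avg X (\<lambda>x. p x * (f x - a x) * G' x) = avg X (\<lambda>x. f x * (p x * G' x)) - avg X (\<lambda>x. p x * a x * G' x)"
    by (simp only: avg_diff[symmetric]) (intro avg_cong, simp add: algebra_simps)
  moreover have "avg X (\<lambda>x. f x * (p x * G' x)) = avg X (\<lambda>x. b x * (p x * G' x))"
    using pinv' G' by (intro projb[symmetric]) blast
  moreover have "avg X (\<lambda>x. b x * (p x * G' x)) - avg X (\<lambda>x. p x * a x * G' x) =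
      avg X (\<lambda>x. (p x * (1 - q x) * (b x - a x)) * G' x) + avg X (\<lambda>x. p x * q x * (b x - a x) * G' x)"
    by (simp only: avg_add[symmetric] avg_diff[symmetric]) (intro avg_cong, simp add: algebra_simps)
  moreover have G'C: "\<bar>G' x\<bar> \<le> C + 1" if "x \<in> X" for x
    using G[OF that] GG'[OF that] \<epsilon> by linarith
  have "\<bar>avg X (\<lambda>x. p x * q x * (b x - a x) * G' x)\<bar> \<le> avg X (\<lambda>x. q x * (b x + p x * a x) * (C + 1))"
  proof (rule avg_abs_mono)
    fix x assume x: "x \<in> X"
    have "\<bar>p x * q x * (b x - a x)\<bar> \<le> q x * (b x + p x * a x)"
      using p01[of x] q01[of x] a0[of x] b0[of x] by auto
    then show "\<bar>p x * q x * (b x - a x) * G' x\<bar> \<le> q x * (b x + p x * a x) * (C + 1)"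
      unfolding abs_mult[of _ "G' x"] using G'C[OF x] by (intro mult_mono) auto
  qed
  moreover have "avg X (\<lambda>x. q x * (b x + p x * a x) * (C + 1)) \<le> \<epsilon> / 4"
  proof -
    have "avg X (\<lambda>x. q x * (b x + p x * a x) * (C + 1)) \<le> 3 * \<rho> * (C + 1)"
      unfolding avg_cmult_right using qbound C by (intro mult_right_mono) auto
    also have "\<dots> \<le> \<epsilon> / 4" using \<rho>(1) C by (simp add: field_simps)
    finally show ?thesis .
  qed
  \<comment> \<open>Of the correlation \<open>\<epsilon>\<close>, discretizing \<open>G\<close>
    costs at most \<open>\<epsilon> / 2\<close> and the new bad set at most
    \<open>\<epsilon> / 4\<close>.\<close>
  ultimately have "\<epsilon> / 4 < \<bar>avg X (\<lambda>x. (p x * (1 - q x) * (b x - a x)) * G' x)\<bar>"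
    using corr' 1 by linarith
  then have "(\<epsilon> / 4)\<^sup>2 \<le> (avg X (\<lambda>x. (p x * (1 - q x) * (b x - a x)) * G' x))\<^sup>2"
    using \<epsilon> by (simp add: abs_le_square_iff[symmetric])
  also have "\<dots> \<le> avg X (\<lambda>x. (p x * (1 - q x) * (b x - a x))\<^sup>2) * avg X (\<lambda>x. (G' x)\<^sup>2)"
    by (rule avg_Cauchy_Schwarz)
  also have "\<dots> \<le> avg X (\<lambda>x. (p x * (1 - q x) * (b x - a x))\<^sup>2) * (C + 1)\<^sup>2"
  proof (rule mult_left_mono)
    have "avg X (\<lambda>x. (G' x)\<^sup>2) \<le> avg X (\<lambda>_. (C + 1)\<^sup>2)"
      by (rule avg_mono) (use C in \<open>simp add: abs_le_square_iff[symmetric] G'C\<close>)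
    then show "avg X (\<lambda>x. (G' x)\<^sup>2) \<le> (C + 1)\<^sup>2" using X by (simp add: avg_const)
  qed (auto intro: avg_nonneg)
  finally have 2: "\<epsilon>\<^sup>2 / (16 * (C + 1)\<^sup>2) \<le> avg X (\<lambda>x. (p x * (1 - q x) * (b x - a x))\<^sup>2)"
    using C by (simp add: field_simps)
  \<comment> \<open>The orthogonality behind Pythagoras: \<open>b - a\<close> is orthogonal to
    \<open>p * a\<close>, which depends only on the old label.\<close>
  have zero: "avg X (\<lambda>x. b x * (p x * a x)) = avg X (\<lambda>x. a x * (p x * a x))"
  proof -
    have "avg X (\<lambda>x. b x * (p x * a x)) = avg X (\<lambda>x. f x * (p x * a x))"
      using pinv' a_inv refine by (intro projb) blast
    moreover have "avg X (\<lambda>x. a x * (p x * a x)) = avg X (\<lambda>x. f x * (p x * a x))"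
      by (rule proja) (metis p_inv a_inv)
    ultimately show ?thesis by simp
  qed
  have cross: "\<bar>avg X (\<lambda>x. p x * q x * (b x - a x) * a x)\<bar> \<le> 6 * \<rho>"
  proof -
    have "\<bar>avg X (\<lambda>x. p x * q x * (b x - a x) * a x)\<bar> \<le> avg X (\<lambda>x. 2 * (q x * (b x + p x * a x)))"
    proof (rule avg_abs_mono)
      fix x assume x: "x \<in> X"
      have "\<bar>q x * (b x - a x)\<bar> * (p x * a x) \<le> \<bar>q x * (b x - a x)\<bar> * 2"
        using pa[OF x] by (intro mult_left_mono) auto
      moreover have "\<bar>b x - a x\<bar> \<le> b x + a x" using a0[of x] b0[of x] by auto
      ultimately show "\<bar>p x * q x * (b x - a x) * a x\<bar> \<le> 2 * (q x * (b x + p x * a x))"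
        using p01[of x] q01[of x] a0[of x] b0[of x] by (auto simp: abs_mult)
    qed
    then show ?thesis using qbound by (simp add: avg_cmult)
  qed
  have sq: "avg X (\<lambda>x. p x * q x * (a x)\<^sup>2) \<le> 4 * \<rho>"
  proof -
    have "avg X (\<lambda>x. p x * q x * (a x)\<^sup>2) \<le> avg X (\<lambda>x. 4 * q x)"
    proof (rule avg_mono)
      fix x assume x: "x \<in> X"
      show "p x * q x * (a x)\<^sup>2 \<le> 4 * q x"
        using pa[OF x] p01[of x] q01[of x] a0[of x] power_mono[of "a x" 2 2] by auto
    qed
    also have "\<dots> \<le> 4 * \<rho>" using \<rho>1 by (simp add: avg_cmult q_def[abs_def])
    finally show ?thesis .
  qed
  \<comment> \<open>Adding twice the vanishing difference from \<open>zero\<close> makes the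
    inequality pointwise: it is an equality where \<open>p x = 1\<close>, and where
    \<open>p x = 0\<close> its left side is 0.\<close>
  have "energy X \<phi> \<nu> \<delta> f + avg X (\<lambda>x. (p x * (1 - q x) * (b x - a x))\<^sup>2) - avg X (\<lambda>x. p x * q x * (a x)\<^sup>2)
      - 2 * avg X (\<lambda>x. p x * q x * (b x - a x) * a x)
    = energy X \<phi> \<nu> \<delta> f + avg X (\<lambda>x. (p x * (1 - q x) * (b x - a x))\<^sup>2) - avg X (\<lambda>x. p x * q x * (a x)\<^sup>2)
      - 2 * avg X (\<lambda>x. p x * q x * (b x - a x) * a x)
      + 2 * (avg X (\<lambda>x. b x * (p x * a x)) - avg X (\<lambda>x. a x * (p x * a x)))"
    using zero by simp
  also have "\<dots> = avg X (\<lambda>x. p x * (a x)\<^sup>2 + (p x * (1 - q x) * (b x - a x))\<^sup>2 - p x * q x * (a x)\<^sup>2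
      - 2 * (p x * q x * (b x - a x) * a x) + 2 * (b x * (p x * a x) - a x * (p x * a x)))"
    by (simp add: energy_def avg_add avg_diff avg_cmult p_def a_def)
  also have "\<dots> \<le> avg X (\<lambda>x. (1 - q x) * (b x)\<^sup>2)"
  proof (rule avg_mono)
    fix x
    show "p x * (a x)\<^sup>2 + (p x * (1 - q x) * (b x - a x))\<^sup>2 - p x * q x * (a x)\<^sup>2
      - 2 * (p x * q x * (b x - a x) * a x) + 2 * (b x * (p x * a x) - a x * (p x * a x))
      \<le> (1 - q x) * (b x)\<^sup>2"
      using p01[of x] q01[of x] by (auto simp: power2_eq_square algebra_simps)
  qed
  also have "\<dots> = energy X \<psi> \<nu> \<delta> f" by (simp add: energy_def q_def b_def)
  finally have "energy X \<phi> \<nu> \<delta> f + \<epsilon>\<^sup>2 / (16 * (C + 1)\<^sup>2) - 16 * \<rho> \<le> energy X \<psi> \<nu> \<delta> f"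
    using 2 cross sq by linarith
  \<comment> \<open>The losses are \<open>4 * \<rho>\<close> from \<open>sq\<close> and twice
    \<open>6 * \<rho>\<close> from \<open>cross\<close>; the constant 512 = 16 * 32 makes them at
    most half of the gain.\<close>
  moreover have "16 * \<rho> \<le> \<epsilon>\<^sup>2 / (32 * (C + 1)\<^sup>2)" using \<rho>(2) by (simp add: field_simps)
  moreover have "\<epsilon>\<^sup>2 / (16 * (C + 1)\<^sup>2) = 2 * (\<epsilon>\<^sup>2 / (32 * (C + 1)\<^sup>2))" by simp
  ultimately show ?thesis by linarith
qed

section \<open>Level sets\<close>

definition cell :: "real \<Rightarrow> nat \<Rightarrow> nat \<Rightarrow> real \<Rightarrow> int" where
  "cell \<eta> T t s = \<lfloor>s / \<eta> + t / T\<rfloor>"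

text \<open>Only in this zone does the indicator function of a cell differ from its continuous substitute \<open>bump\<close>;
  some offset \<open>t < T\<close> makes the zone light.\<close>

definition boundary :: "real \<Rightarrow> nat \<Rightarrow> nat \<Rightarrow> real \<Rightarrow> bool" where
  "boundary \<eta> T t s \<longleftrightarrow> frac (s / \<eta> + t / T) < 1 / T"

text \<open>A trapezoid in units of \<open>\<eta>\<close>: it rises on the first
  \<open>1 / T\<close> of cell \<open>i\<close> and falls on the first \<open>1 / T\<close> of the
  next cell, so that both ramps lie where \<open>boundary\<close> holds.\<close>

definition bump :: "real \<Rightarrow> nat \<Rightarrow> nat \<Rightarrow> int \<Rightarrow> real \<Rightarrow> real" where
  "bump \<eta> T t i s = (let u = s / \<eta> + t / T - i in max 0 (min 1 (min (T * u) (1 + T * (1 - u)))))"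

text \<open>The offset is attached to the function and not to its place in the list, so prepending a
  function refines the partition. Lists as labels give all stages of the refinement the same
  type.\<close>

definition coloring :: "real \<Rightarrow> nat \<Rightarrow> (('b \<Rightarrow> real) \<Rightarrow> nat) \<Rightarrow> ('b \<Rightarrow> real) list \<Rightarrow> 'b \<Rightarrow> int list" where
  "coloring \<eta> T off Gs x = map (\<lambda>G. cell \<eta> T (off G) (G x)) Gs"

lemma bump_range: "0 \<le> bump \<eta> T t i s" "bump \<eta> T t i s \<le> 1"
  by (auto simp: bump_def Let_def)

lemma continuous_on_bump: "0 < \<eta> \<Longrightarrow> continuous_on S (bump \<eta> T t i)"
  unfolding bump_def Let_def by (intro continuous_intros) auto

text \<open>Outside the zone, \<open>s / \<eta> + t / T\<close> lies at least \<open>1 / T\<close>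
  above the lower end of its own cell: on the plateau if that is cell \<open>i\<close>, otherwise
  below the rising ramp or past the falling one.\<close>

lemma bump_eq_cell:
  assumes "0 < T" "\<not> boundary \<eta> T t s"
  shows "bump \<eta> T t i s = of_bool (cell \<eta> T t s = i)"
proof -
  define u where "u = s / \<eta> + t / T"
  define k where "k = \<lfloor>u\<rfloor>"
  have lo: "1 / T \<le> u - k" and hi: "u - k < 1"
    using assms frac_lt_1[of u] by (auto simp: boundary_def u_def k_def frac_def)
  have T: "real T > 0" using assms by simp
  have lo': "1 \<le> T * (u - k)" using lo T by (simp add: field_simps)
  consider "k = i" | "k + 1 \<le> i" | "i + 1 \<le> k" by linarith
  then show ?thesis
  proof cases
    case 1
    then have "T * (1 - (u - i)) \<ge> 0" using hi T by (intro mult_nonneg_nonneg) auto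
    then show ?thesis using 1 lo' by (auto simp: bump_def cell_def Let_def u_def k_def)
  next
    case 2
    then have "real_of_int k + 1 \<le> i" by linarith
    then have "T * (u - i) \<le> 0" using hi T by (intro mult_nonneg_nonpos) auto
    then show ?thesis using 2 by (auto simp: bump_def cell_def Let_def u_def k_def)
  next
    case 3
    then have "real_of_int i + 1 \<le> k" by linarith
    then have "T * (u - k) \<le> T * (u - i - 1)" using T by (intro mult_left_mono) auto
    then have "1 + T * (1 - (u - i)) \<le> 0" using lo' by (simp add: algebra_simps)
    then show ?thesis using 3 by (auto simp: bump_def cell_def Let_def u_def k_def)
  qed
qed

text \<open>Two distinct shifts differ by at least \<open>1 / T\<close> and at most
  \<open>1 - 1 / T\<close>, so they cannot both bring the fractional part into a window of length
  \<open>1 / T\<close>.\<close>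

lemma boundary_disjoint:
  assumes "t < t'" "t' < T" shows "\<not> (boundary \<eta> T t s \<and> boundary \<eta> T t' s)"
proof
  assume *: "boundary \<eta> T t s \<and> boundary \<eta> T t' s"
  define u where "u = s / \<eta> + t / T"
  define u' where "u' = s / \<eta> + t' / T"
  have T: "real T > 0" using assms by simp
  have "u' - u = (real t' - real t) / T" by (simp add: u_def u'_def diff_divide_distrib)
  moreover have "1 \<le> real t' - real t" "real t' - real t \<le> T - 1" using assms by linarith+
  ultimately have d: "1 / T \<le> u' - u" "u' - u \<le> 1 - 1 / T"
    using T by (simp_all add: field_simps)
  have "frac u < 1 / T" "frac u' < 1 / T" "0 \<le> frac u" "0 \<le> frac u'"
    using * by (auto simp: boundary_def u_def u'_def)
  moreover have "u' - u = real_of_int (\<lfloor>u'\<rfloor> - \<lfloor>u\<rfloor>) + (frac u' - frac u)" by (simp add: frac_def)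
  ultimately have "0 < real_of_int (\<lfloor>u'\<rfloor> - \<lfloor>u\<rfloor>)" "real_of_int (\<lfloor>u'\<rfloor> - \<lfloor>u\<rfloor>) < 1" using d by linarith+
  then show False unfolding of_int_0_less_iff of_int_less_1_iff by linarith
qed

text \<open>Pigeonhole: the \<open>T\<close> zones are disjoint, so their weights add up to at most
  the total weight.\<close>

lemma offset_exists:
  assumes "0 < T" "\<And>x. x \<in> X \<Longrightarrow> 0 \<le> w x"
  shows "\<exists>t<T. avg X (\<lambda>x. w x * of_bool (boundary \<eta> T t (G x))) \<le> avg X w / T"
proof (rule ccontr)
  assume "\<not> ?thesis"
  then have *: "avg X w / T < avg X (\<lambda>x. w x * of_bool (boundary \<eta> T t (G x)))" if "t \<in> {..<T}" for t
    using that by (auto simp: not_le)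
  have "(\<Sum>t<T. avg X w / T) < (\<Sum>t<T. avg X (\<lambda>x. w x * of_bool (boundary \<eta> T t (G x))))"
    using * assms(1) by (intro sum_strict_mono) auto
  also have "\<dots> = avg X (\<lambda>x. w x * (\<Sum>t<T. of_bool (boundary \<eta> T t (G x))))"
    by (simp only: avg_sum[symmetric] sum_distrib_left)
  also have "\<dots> \<le> avg X (\<lambda>x. w x * 1)"
  proof (intro avg_mono mult_left_mono assms(2))
    fix x
    have "card {t. t < T \<and> boundary \<eta> T t (G x)} \<le> 1"
      by (rule card_le_Suc0_iff_eq[THEN iffD2, unfolded One_nat_def[symmetric]])
        (auto dest: boundary_disjoint[of _ _ T \<eta> "G x"] simp: nat_neq_iff, metis boundary_disjoint nat_neq_iff)
    then show "(\<Sum>t<T. of_bool (boundary \<eta> T t (G x)) :: real) \<le> 1"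
      by (simp add: of_bool_def sum.If_cases Int_def)
  qed
  finally show False using assms(1) by simp
qed

lemma prod_list_bounded:
  "(\<And>a. a \<in> set as \<Longrightarrow> \<bar>a\<bar> \<le> c) \<Longrightarrow> \<bar>prod_list as\<bar> \<le> c ^ length as" for c :: real
  by (induction as) (auto simp: abs_mult intro!: mult_mono order_trans[OF abs_ge_zero])

text \<open>Telescoping: two products of factors in [0, 1] differ by at most the sum of the
  differences of their factors, and a factor changes only in its zone.\<close>

lemma abs_prod_map2_bump_le:
  fixes off :: "('b \<Rightarrow> real) \<Rightarrow> nat" and \<eta> :: real
  assumes "0 < T" "length cs = length Gs"
  defines "P \<equiv> \<lambda>cs Gs x. prod_list (map2 (\<lambda>\<phi> G. \<phi> (G x)) (map2 (\<lambda>c G. bump \<eta> T (off G) c) cs Gs) Gs)"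
  shows "0 \<le> P cs Gs x" "P cs Gs x \<le> 1"
    "\<bar>of_bool (coloring \<eta> T off Gs x = cs) - P cs Gs x\<bar>
      \<le> (\<Sum>G\<leftarrow>Gs. of_bool (boundary \<eta> T (off G) (G x)))"
proof -
  have "0 \<le> P cs Gs x \<and> P cs Gs x \<le> 1 \<and>
    \<bar>of_bool (coloring \<eta> T off Gs x = cs) - P cs Gs x\<bar>
      \<le> (\<Sum>G\<leftarrow>Gs. of_bool (boundary \<eta> T (off G) (G x)))"
    using assms(2)
  proof (induction cs Gs rule: list_induct2)
    case (Cons c cs G Gs)
    let ?b = "bump \<eta> T (off G) c (G x)" and ?a = "of_bool (cell \<eta> T (off G) (G x) = c) :: real"
    let ?A = "of_bool (coloring \<eta> T off Gs x = cs) :: real"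
    have P: "P (c # cs) (G # Gs) x = ?b * P cs Gs x" by (simp add: P_def)
    have "\<bar>?a - ?b\<bar> \<le> of_bool (boundary \<eta> T (off G) (G x))"
      using bump_eq_cell[OF assms(1)] bump_range[of \<eta> T "off G" c "G x"]
      by (cases "boundary \<eta> T (off G) (G x)") auto
    moreover have "\<bar>?a * ?A - ?b * P cs Gs x\<bar> \<le> \<bar>?a - ?b\<bar> + \<bar>?A - P cs Gs x\<bar>"
    proof -
      have "?a * ?A - ?b * P cs Gs x = (?a - ?b) * ?A + ?b * (?A - P cs Gs x)" by (simp add: algebra_simps)
      also have "\<bar>\<dots>\<bar> \<le> \<bar>?a - ?b\<bar> * \<bar>?A\<bar> + ?b * \<bar>?A - P cs Gs x\<bar>"
        using bump_range[of \<eta> T "off G" c "G x"] abs_triangle_ineq[of "(?a - ?b) * ?A" "?b * (?A - P cs Gs x)"]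
        by (simp add: abs_mult)
      also have "\<dots> \<le> \<bar>?a - ?b\<bar> * 1 + 1 * \<bar>?A - P cs Gs x\<bar>"
        by (intro add_mono mult_mono) (auto simp: bump_range)
      finally show ?thesis by simp
    qed
    moreover have "of_bool (coloring \<eta> T off (G # Gs) x = c # cs) = ?a * ?A"
      by (simp add: coloring_def)
    ultimately show ?case
      using Cons.IH bump_range[of \<eta> T "off G" c "G x"] by (auto simp: P intro: mult_le_one)
  qed (simp add: P_def coloring_def)
  then show "0 \<le> P cs Gs x" "P cs Gs x \<le> 1"
    "\<bar>of_bool (coloring \<eta> T off Gs x = cs) - P cs Gs x\<bar>
      \<le> (\<Sum>G\<leftarrow>Gs. of_bool (boundary \<eta> T (off G) (G x)))" by auto
qed

text \<open>The subtracted number is the lower end of the interval containing \<open>s\<close>. It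
  recovers a dual function from its label up to \<open>\<eta>\<close>, and so supplies
  \<open>G'\<close> in \<open>energy_increment\<close>.\<close>

lemma cell_representative:
  assumes "0 < T" "0 < \<eta>" shows "\<bar>s - \<eta> * (cell \<eta> T t s - t / T)\<bar> \<le> \<eta>"
proof -
  have "real_of_int (cell \<eta> T t s) \<le> s / \<eta> + t / T" "s / \<eta> + t / T < cell \<eta> T t s + 1"
    by (auto simp: cell_def)
  then have "0 \<le> s / \<eta> - (cell \<eta> T t s - t / T)" "s / \<eta> - (cell \<eta> T t s - t / T) \<le> 1" by linarith+
  then have "\<bar>s / \<eta> - (cell \<eta> T t s - t / T)\<bar> \<le> 1" by linarith
  then have "\<eta> * \<bar>s / \<eta> - (cell \<eta> T t s - t / T)\<bar> \<le> \<eta> * 1" using assms by (intro mult_left_mono) auto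
  also have "\<eta> * \<bar>s / \<eta> - (cell \<eta> T t s - t / T)\<bar> = \<bar>\<eta> * (s / \<eta> - (cell \<eta> T t s - t / T))\<bar>"
    using assms by (simp add: abs_mult)
  also have "\<eta> * (s / \<eta> - (cell \<eta> T t s - t / T)) = s - \<eta> * (cell \<eta> T t s - t / T)"
    using assms by (simp add: right_diff_distrib)
  finally show ?thesis by simp
qed

text \<open>This bounds the number of labels independently of N; the 2 absorbs the rounding and the
  shift by less than 1.\<close>

lemma cell_bounded:
  assumes "0 < \<eta>" "\<bar>s\<bar> \<le> C" "t < T"
  shows "cell \<eta> T t s \<in> {- (\<lceil>C / \<eta>\<rceil> + 2) .. \<lceil>C / \<eta>\<rceil> + 2}"
proof -
  have "\<bar>s / \<eta>\<bar> \<le> C / \<eta>" using assms by (simp add: abs_divide divide_right_mono)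
  moreover have "0 \<le> real t / T" "real t / T \<le> 1" using assms by auto
  moreover have "C / \<eta> \<le> \<lceil>C / \<eta>\<rceil>" by simp
  moreover have "real_of_int (cell \<eta> T t s) \<le> s / \<eta> + t / T" "s / \<eta> + t / T < cell \<eta> T t s + 1"
    by (auto simp: cell_def)
  ultimately have "- real_of_int (\<lceil>C / \<eta>\<rceil> + 2) \<le> cell \<eta> T t s" "cell \<eta> T t s \<le> real_of_int (\<lceil>C / \<eta>\<rceil> + 2)"
    by linarith+
  then show ?thesis by (metis atLeastAtMost_iff of_int_le_iff of_int_minus)
qed

section \<open>Weak regularity for an abstract family of bounded dual functions\<close>

locale dual_system =
  fixes X :: "nat \<Rightarrow> 'b set" and \<nu> :: "nat \<Rightarrow> 'b \<Rightarrow> real" and \<D> :: "nat \<Rightarrow> ('b \<Rightarrow> real) set" and C :: real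
  assumes finite_X: "finite (X N)" and nonempty_X: "X N \<noteq> {}"
    and nonneg: "x \<in> X N \<Longrightarrow> 0 \<le> \<nu> N x"
    and C: "1 \<le> C"
    and dual_bound: "G \<in> \<D> N \<Longrightarrow> x \<in> X N \<Longrightarrow> \<bar>G x\<bar> \<le> C"
    and dual_orth: "0 < \<kappa> \<Longrightarrow> \<forall>\<^sub>F N in sequentially. \<forall>Gs. length Gs = K \<and> set Gs \<subseteq> \<D> N \<longrightarrow>
      \<bar>avg (X N) (\<lambda>x. (\<nu> N x - 1) * (\<Prod>G\<leftarrow>Gs. G x))\<bar> \<le> \<kappa>"
begin

lemma eventually_avg_le: "\<forall>\<^sub>F N in sequentially. avg (X N) (\<nu> N) \<le> 2"
proof -
  \<comment> \<open>The empty list of dual functions, whose product is 1.\<close>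
  have "\<forall>\<^sub>F N in sequentially. \<bar>avg (X N) (\<lambda>x. \<nu> N x - 1)\<bar> \<le> 1" using dual_orth[of 1 0] by simp
  then show ?thesis
    by eventually_elim (simp add: avg_diff avg_const finite_X nonempty_X)
qed

text \<open>Induction on the number of continuous factors: the first one is replaced by a
  polynomial, and a monomial of degree \<open>i\<close> in \<open>G\<close> is absorbed by adding
  \<open>i\<close> copies of \<open>G\<close> to the plain factors \<open>Hs\<close>. This is why
  \<open>K\<close> and \<open>\<kappa>\<close> vary in the induction. The polynomial depends neither
  on N nor on the dual functions, so uniformity in them survives.\<close>

lemma orth_continuous:
  assumes "\<And>\<phi>. \<phi> \<in> set \<phi>s \<Longrightarrow> continuous_on {-C..C} \<phi> \<and> (\<forall>s. \<bar>\<phi> s\<bar> \<le> 1)" "0 < \<kappa>"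
  shows "\<forall>\<^sub>F N in sequentially. \<forall>Gs Hs. length Gs = length \<phi>s \<and> set Gs \<subseteq> \<D> N \<and>
      length Hs = K \<and> set Hs \<subseteq> \<D> N \<longrightarrow>
      \<bar>avg (X N) (\<lambda>x. (\<nu> N x - 1) * (prod_list (map2 (\<lambda>\<phi> G. \<phi> (G x)) \<phi>s Gs) * (\<Prod>H\<leftarrow>Hs. H x)))\<bar> \<le> \<kappa>"
  using assms
proof (induction \<phi>s arbitrary: K \<kappa>)
  case Nil
  show ?case using dual_orth[OF Nil(2), of K] by (auto elim: eventually_mono)
next
  case (Cons \<phi> \<phi>s)
  \<comment> \<open>Half of \<open>\<kappa>\<close> is reserved for the approximation error, which
    is tested against \<open>\<nu> + 1\<close>, of average at most 3, and against factors of size at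
    most \<open>C ^ K\<close>.\<close>
  define \<rho> where "\<rho> = \<kappa> / (6 * C ^ K)"
  have CK: "1 \<le> C ^ K" using C by (simp add: one_le_power)
  have \<rho>: "0 < \<rho>" using Cons.prems(2) CK by (auto simp: \<rho>_def intro!: divide_pos_pos)
  obtain g where g: "real_polynomial_function g" "\<And>s. s \<in> {-C..C} \<Longrightarrow> \<bar>\<phi> s - g s\<bar> < \<rho>"
    using Stone_Weierstrass_real_polynomial_function[of "{-C..C}" \<phi> \<rho>] Cons.prems(1)[of \<phi>] \<rho> by auto
  obtain a n where an: "g = (\<lambda>s. \<Sum>i\<le>n. a i * s ^ i)"
    using g(1) by (auto simp: real_polynomial_function_iff_sum)
  \<comment> \<open>The added 1 keeps \<open>S\<close> positive even if all coefficients
    vanish.\<close>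
  define S where "S = (\<Sum>i\<le>n. \<bar>a i\<bar>) + 1"
  have S: "0 < S" unfolding S_def by (intro add_nonneg_pos sum_nonneg) auto
  let ?P = "\<lambda>Gs x. prod_list (map2 (\<lambda>\<phi> G. \<phi> (G x)) \<phi>s Gs)"
  have "\<forall>\<^sub>F N in sequentially. \<forall>i\<in>{..n}. \<forall>Gs Hs. length Gs = length \<phi>s \<and> set Gs \<subseteq> \<D> N \<and>
      length Hs = K + i \<and> set Hs \<subseteq> \<D> N \<longrightarrow>
      \<bar>avg (X N) (\<lambda>x. (\<nu> N x - 1) * (?P Gs x * (\<Prod>H\<leftarrow>Hs. H x)))\<bar> \<le> \<kappa> / (2 * S)"
    using Cons S by (intro eventually_ball_finite ballI Cons.IH) auto
  then show ?case using eventually_avg_le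
  proof eventually_elim
    case (elim N)
    show ?case
    proof (intro allI impI)
      fix Gs' Hs assume *: "length Gs' = length (\<phi> # \<phi>s) \<and> set Gs' \<subseteq> \<D> N \<and> length Hs = K \<and> set Hs \<subseteq> \<D> N"
      then obtain G Gs where Gs': "Gs' = G # Gs" by (cases Gs') auto
      have len: "length Gs = length \<phi>s" and D: "G \<in> \<D> N" "set Gs \<subseteq> \<D> N" "set Hs \<subseteq> \<D> N" "length Hs = K"
        using * Gs' by auto
      define Q where "Q x = ?P Gs x * (\<Prod>H\<leftarrow>Hs. H x)" for x
      have Q: "\<bar>Q x\<bar> \<le> C ^ K" if "x \<in> X N" for x
      proof -
        have "\<bar>?P Gs x\<bar> \<le> 1 ^ length (map2 (\<lambda>\<phi> G. \<phi> (G x)) \<phi>s Gs)"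
          by (rule prod_list_bounded) (use Cons.prems in \<open>auto simp: set_zip\<close>)
        moreover have "\<bar>\<Prod>H\<leftarrow>Hs. H x\<bar> \<le> C ^ length (map (\<lambda>H. H x) Hs)"
          by (rule prod_list_bounded) (use D dual_bound that in auto)
        ultimately have "\<bar>?P Gs x\<bar> * \<bar>\<Prod>H\<leftarrow>Hs. H x\<bar> \<le> 1 * C ^ K"
          using D by (intro mult_mono) auto
        then show ?thesis by (simp add: Q_def abs_mult)
      qed
      have "\<bar>avg (X N) (\<lambda>x. (\<nu> N x - 1) * ((\<phi> (G x) - g (G x)) * Q x))\<bar>
          \<le> avg (X N) (\<lambda>x. (\<nu> N x + 1) * (\<rho> * C ^ K))"
      proof (rule avg_abs_mono)
        fix x assume x: "x \<in> X N"
        have "G x \<in> {-C..C}" using dual_bound[OF D(1) x] by (auto simp: abs_le_iff)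
        then have "\<bar>\<phi> (G x) - g (G x)\<bar> \<le> \<rho>" using g(2) less_imp_le by blast
        then have "\<bar>(\<phi> (G x) - g (G x)) * Q x\<bar> \<le> \<rho> * C ^ K"
          unfolding abs_mult using Q[OF x] \<rho> by (intro mult_mono) auto
        moreover have "\<bar>\<nu> N x - 1\<bar> \<le> \<nu> N x + 1" using nonneg[OF x] by auto
        ultimately show "\<bar>(\<nu> N x - 1) * ((\<phi> (G x) - g (G x)) * Q x)\<bar> \<le> (\<nu> N x + 1) * (\<rho> * C ^ K)"
          unfolding abs_mult[of "\<nu> N x - 1"] using nonneg[OF x] by (intro mult_mono) auto
      qed
      also have "\<dots> = (avg (X N) (\<nu> N) + 1) * (\<rho> * C ^ K)"
        by (simp add: avg_cmult_right avg_add avg_const finite_X nonempty_X del: mult_cancel_right)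
      also have "\<dots> \<le> 3 * (\<rho> * C ^ K)"
        using elim \<rho> CK by (intro mult_right_mono) auto
      also have "\<dots> = \<kappa> / 2" using C by (simp add: \<rho>_def)
      finally have 1: "\<bar>avg (X N) (\<lambda>x. (\<nu> N x - 1) * ((\<phi> (G x) - g (G x)) * Q x))\<bar> \<le> \<kappa> / 2" .
      have monom: "\<bar>avg (X N) (\<lambda>x. (\<nu> N x - 1) * (G x ^ i * Q x))\<bar> \<le> \<kappa> / (2 * S)" if "i \<le> n" for i
      proof -
        have "set (replicate i G @ Hs) \<subseteq> \<D> N" using D by auto
        moreover have "length (replicate i G @ Hs) = K + i" using D by simp
        ultimately have "\<bar>avg (X N) (\<lambda>x. (\<nu> N x - 1) * (?P Gs x * (\<Prod>H\<leftarrow>replicate i G @ Hs. H x)))\<bar> \<le> \<kappa> / (2 * S)"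
          using elim(1) that len D(2) by blast
        moreover have "(\<lambda>x. (\<nu> N x - 1) * (?P Gs x * (\<Prod>H\<leftarrow>replicate i G @ Hs. H x))) =
            (\<lambda>x. (\<nu> N x - 1) * (G x ^ i * Q x))"
          by (simp add: Q_def prod_list_replicate mult_ac)
        ultimately show ?thesis by simp
      qed
      have "avg (X N) (\<lambda>x. (\<nu> N x - 1) * (g (G x) * Q x)) =
          avg (X N) (\<lambda>x. \<Sum>i\<le>n. a i * ((\<nu> N x - 1) * (G x ^ i * Q x)))"
        by (simp add: an sum_distrib_left sum_distrib_right mult_ac)
      also have "\<dots> = (\<Sum>i\<le>n. a i * avg (X N) (\<lambda>x. (\<nu> N x - 1) * (G x ^ i * Q x)))"
        by (simp add: avg_sum avg_cmult)
      also have "\<bar>\<dots>\<bar> \<le> (\<Sum>i\<le>n. \<bar>a i\<bar> * (\<kappa> / (2 * S)))"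
        by (rule order_trans[OF sum_abs sum_mono]) (auto simp only: abs_mult atMost_iff intro!: mult_left_mono monom)
      also have "\<dots> = (S - 1) * (\<kappa> / (2 * S))" by (simp only: sum_distrib_right[symmetric]) (simp add: S_def)
      also have "\<dots> \<le> S * (\<kappa> / (2 * S))" using S Cons.prems(2) by (intro mult_right_mono) auto
      also have "\<dots> = \<kappa> / 2" using S by simp
      finally have 2: "\<bar>avg (X N) (\<lambda>x. (\<nu> N x - 1) * (g (G x) * Q x))\<bar> \<le> \<kappa> / 2" .
      have "avg (X N) (\<lambda>x. (\<nu> N x - 1) * (prod_list (map2 (\<lambda>\<phi> G. \<phi> (G x)) (\<phi> # \<phi>s) Gs') * (\<Prod>H\<leftarrow>Hs. H x)))
        = avg (X N) (\<lambda>x. (\<nu> N x - 1) * ((\<phi> (G x) - g (G x)) * Q x)) + avg (X N) (\<lambda>x. (\<nu> N x - 1) * (g (G x) * Q x))"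
        by (simp only: avg_add[symmetric]) (intro avg_cong, simp add: Q_def Gs' algebra_simps)
      then show "\<bar>avg (X N) (\<lambda>x. (\<nu> N x - 1) * (prod_list (map2 (\<lambda>\<phi> G. \<phi> (G x)) (\<phi> # \<phi>s) Gs') * (\<Prod>H\<leftarrow>Hs. H x)))\<bar> \<le> \<kappa>"
        using 1 2 by linarith
    qed
  qed
qed

text \<open>\<open>U\<close> is a union of boundedly many classes. The indicator of a class is a
  product of cell indicators, which are replaced by continuous bumps; the error lives in the zones,
  and these carry little mass of \<open>\<nu> + 1 \<ge> \<bar>\<nu> - 1\<bar>\<close> by the choice
  of the offsets.\<close>

lemma orth_saturated:
  assumes \<tau>: "0 < \<tau>" and \<eta>: "0 < \<eta>"
  shows "\<exists>T>0. \<forall>\<^sub>F N in sequentially. \<exists>off. \<forall>Gs. length Gs \<le> m \<and> set Gs \<subseteq> \<D> N \<longrightarrow>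
    (\<forall>U\<in>saturated_sets (X N) (coloring \<eta> T off Gs). \<bar>avg (X N) (\<lambda>x. indicator U x * (\<nu> N x - 1))\<bar> \<le> \<tau>)"
proof -
  define L where "L = {- (\<lceil>C / \<eta>\<rceil> + 2) .. \<lceil>C / \<eta>\<rceil> + 2}"
  define A where "A = real (card L + 1) ^ m"
  have A: "1 \<le> A" unfolding A_def by (intro one_le_power) auto
  \<comment> \<open>\<open>A\<close> will bound the number of classes in \<open>U\<close>, and this
    \<open>T\<close> makes the zone error \<open>m * (3 / T)\<close> of one class at most
    \<open>\<tau> / (2 * A)\<close>.\<close>
  obtain T :: nat where T: "6 * m * A / \<tau> < T" using reals_Archimedean2 by blast
  moreover have "0 \<le> 6 * m * A / \<tau>" using \<tau> A by auto
  ultimately have T0: "0 < T" using of_nat_0_less_iff[where ?'a=real] by linarith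
  \<comment> \<open>The offsets depend on N and on the dual functions, but all products of bumps
    that can occur are indexed by this finite set, which is fixed before N. Finitely many eventual
    statements then hold simultaneously.\<close>
  define I where "I = {(ts, cs) | ts cs. length ts = length cs \<and> length cs \<le> m \<and> set ts \<subseteq> {..<T} \<and> set cs \<subseteq> L}"
  have "finite I"
  proof (rule finite_subset)
    show "I \<subseteq> {ts. set ts \<subseteq> {..<T} \<and> length ts \<le> m} \<times> {cs. set cs \<subseteq> L \<and> length cs \<le> m}"
      by (auto simp: I_def)
  qed (auto intro!: finite_cartesian_product finite_lists_length_le simp: L_def)
  let ?B = "\<lambda>ts cs. map2 (\<lambda>c t. bump \<eta> T t c) cs ts"
  have "\<forall>\<^sub>F N in sequentially. \<forall>i\<in>I. \<forall>Gs Hs. length Gs = length (?B (fst i) (snd i)) \<and> set Gs \<subseteq> \<D> N \<and>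
      length Hs = 0 \<and> set Hs \<subseteq> \<D> N \<longrightarrow>
      \<bar>avg (X N) (\<lambda>x. (\<nu> N x - 1) * (prod_list (map2 (\<lambda>\<phi> G. \<phi> (G x)) (?B (fst i) (snd i)) Gs) * (\<Prod>H\<leftarrow>Hs. H x)))\<bar> \<le> \<tau> / (2 * A)"
  proof (intro eventually_ball_finite \<open>finite I\<close> ballI orth_continuous)
    show "0 < \<tau> / (2 * A)" using \<tau> A by simp
  next
    fix i \<phi> assume "\<phi> \<in> set (?B (fst i) (snd i))"
    then obtain c t where "\<phi> = bump \<eta> T t c" by (auto simp: set_zip)
    then show "continuous_on {- C..C} \<phi> \<and> (\<forall>s. \<bar>\<phi> s\<bar> \<le> 1)"
      using bump_range[of \<eta> T t c] continuous_on_bump[OF \<eta>] by (auto simp: abs_le_iff intro: order_trans[of _ 0])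
  qed
  then have "\<forall>\<^sub>F N in sequentially. \<exists>off. \<forall>Gs. length Gs \<le> m \<and> set Gs \<subseteq> \<D> N \<longrightarrow>
    (\<forall>U\<in>saturated_sets (X N) (coloring \<eta> T off Gs). \<bar>avg (X N) (\<lambda>x. indicator U x * (\<nu> N x - 1))\<bar> \<le> \<tau>)"
    using eventually_avg_le
  proof eventually_elim
    case (elim N)
    let ?w = "\<lambda>x. \<nu> N x + 1"
    define off where "off G = (SOME t. t < T \<and> avg (X N) (\<lambda>x. ?w x * of_bool (boundary \<eta> T t (G x))) \<le> avg (X N) ?w / T)" for G
    have off: "off G < T \<and> avg (X N) (\<lambda>x. ?w x * of_bool (boundary \<eta> T (off G) (G x))) \<le> avg (X N) ?w / T" for G
      unfolding off_def by (rule someI_ex) (use offset_exists[OF T0, of "X N" ?w \<eta> G] nonneg in fastforce)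
    have w3: "avg (X N) ?w \<le> 3" using elim by (simp add: avg_add avg_const finite_X nonempty_X)
    have offle: "avg (X N) (\<lambda>x. ?w x * of_bool (boundary \<eta> T (off G) (G x))) \<le> 3 / T" for G
      using off[of G] divide_right_mono[OF w3, of T] by simp
    have one: "\<bar>avg (X N) (\<lambda>x. of_bool (coloring \<eta> T off Gs x = cs) * (\<nu> N x - 1))\<bar> \<le> \<tau> / A"
      if Gs: "length Gs \<le> m" "set Gs \<subseteq> \<D> N" and cs: "length cs = length Gs" "set cs \<subseteq> L" for Gs cs
    proof -
      define P where "P x = prod_list (map2 (\<lambda>\<phi> G. \<phi> (G x)) (map2 (\<lambda>c G. bump \<eta> T (off G) c) cs Gs) Gs)" for x
      define Z where "Z x = (\<Sum>G\<leftarrow>Gs. of_bool (boundary \<eta> T (off G) (G x)) :: real)" for x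
      have "(map off Gs, cs) \<in> I" using Gs cs off by (auto simp: I_def)
      from elim(1)[rule_format, OF this, of Gs "[]"]
      have 1: "\<bar>avg (X N) (\<lambda>x. (\<nu> N x - 1) * P x)\<bar> \<le> \<tau> / (2 * A)"
        using Gs cs by (simp add: P_def zip_map2 split_def o_def)
      have "\<bar>avg (X N) (\<lambda>x. (of_bool (coloring \<eta> T off Gs x = cs) - P x) * (\<nu> N x - 1))\<bar> \<le> avg (X N) (\<lambda>x. Z x * ?w x)"
      proof (rule avg_abs_mono)
        fix x assume x: "x \<in> X N"
        have "\<bar>of_bool (coloring \<eta> T off Gs x = cs) - P x\<bar> \<le> Z x"
          using abs_prod_map2_bump_le(3)[OF T0 cs(1)] by (simp add: P_def Z_def)
        moreover have "\<bar>\<nu> N x - 1\<bar> \<le> ?w x" using nonneg[OF x] by auto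
        ultimately show "\<bar>(of_bool (coloring \<eta> T off Gs x = cs) - P x) * (\<nu> N x - 1)\<bar> \<le> Z x * ?w x"
          unfolding abs_mult by (intro mult_mono) auto
      qed
      also have "avg (X N) (\<lambda>x. Z x * ?w x) = (\<Sum>G\<leftarrow>Gs. avg (X N) (\<lambda>x. ?w x * of_bool (boundary \<eta> T (off G) (G x))))"
        unfolding Z_def by (induction Gs) (simp_all add: avg_add distrib_left distrib_right mult_ac avg_def)
      also have "\<dots> \<le> (\<Sum>G\<leftarrow>Gs. 3 / T)" by (rule sum_list_mono) (rule offle)
      also have "\<dots> \<le> m * (3 / T)" using Gs by (simp add: sum_list_triv mult_right_mono divide_right_mono)
      also have "\<dots> \<le> \<tau> / (2 * A)" using T T0 \<tau> A by (simp add: field_simps)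
      finally have 2: "\<bar>avg (X N) (\<lambda>x. (of_bool (coloring \<eta> T off Gs x = cs) - P x) * (\<nu> N x - 1))\<bar> \<le> \<tau> / (2 * A)" .
      have "avg (X N) (\<lambda>x. of_bool (coloring \<eta> T off Gs x = cs) * (\<nu> N x - 1)) =
          avg (X N) (\<lambda>x. (of_bool (coloring \<eta> T off Gs x = cs) - P x) * (\<nu> N x - 1)) + avg (X N) (\<lambda>x. (\<nu> N x - 1) * P x)"
        by (simp only: avg_add[symmetric]) (intro avg_cong, simp add: algebra_simps)
      then show ?thesis using 1 2 by (simp add: field_simps)
    qed
    show ?case
    proof (intro exI[of _ off] allI impI ballI)
      fix Gs U assume Gs: "length Gs \<le> m \<and> set Gs \<subseteq> \<D> N" and U: "U \<in> saturated_sets (X N) (coloring \<eta> T off Gs)"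
      let ?col = "coloring \<eta> T off Gs"
      have UX: "U \<subseteq> X N" using U by (auto simp: saturated_sets_def)
      have fin: "finite (?col ` U)" using UX finite_X finite_subset by blast
      have sub: "?col ` U \<subseteq> {cs. set cs \<subseteq> L \<and> length cs = length Gs}"
      proof safe
        fix x c assume "x \<in> U" "c \<in> set (?col x)"
        then obtain G where "G \<in> set Gs" "c = cell \<eta> T (off G) (G x)" by (auto simp: coloring_def)
        then show "c \<in> L"
          using cell_bounded[OF \<eta>, of "G x" C "off G" T] Gs UX off dual_bound \<open>x \<in> U\<close>
          unfolding L_def by blast
      qed (simp add: coloring_def)
      have "card (?col ` U) \<le> card {cs. set cs \<subseteq> L \<and> length cs = length Gs}"
        by (rule card_mono[OF _ sub]) (auto intro: finite_lists_length_eq simp: L_def)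
      also have "\<dots> = card L ^ length Gs" by (rule card_lists_length_eq) (simp add: L_def)
      also have "\<dots> \<le> (card L + 1) ^ length Gs" by (rule power_mono) auto
      also have "\<dots> \<le> (card L + 1) ^ m" using Gs by (intro power_increasing) auto
      finally have card: "real (card (?col ` U)) \<le> A" unfolding A_def
        by (metis of_nat_le_iff of_nat_power)
      have "avg (X N) (\<lambda>x. indicator U x * (\<nu> N x - 1)) =
          avg (X N) (\<lambda>x. \<Sum>cs\<in>?col ` U. of_bool (?col x = cs) * (\<nu> N x - 1))"
      proof (rule avg_cong)
        fix x assume "x \<in> X N"
        then have "x \<in> U \<longleftrightarrow> ?col x \<in> ?col ` U" using U by (auto simp: saturated_sets_def)
        then show "indicator U x * (\<nu> N x - 1) = (\<Sum>cs\<in>?col ` U. of_bool (?col x = cs) * (\<nu> N x - 1))"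
          using fin by (simp add: sum_distrib_right[symmetric] indicator_def of_bool_def)
      qed
      also have "\<bar>\<dots>\<bar> \<le> (\<Sum>cs\<in>?col ` U. \<tau> / A)"
        unfolding avg_sum by (rule order_trans[OF sum_abs sum_mono]) (use Gs sub in \<open>auto intro!: one\<close>)
      also have "\<dots> \<le> A * (\<tau> / A)" using mult_right_mono[OF card, of "\<tau> / A"] \<tau> A by simp
      also have "\<dots> = \<tau>" using A by simp
      finally show "\<bar>avg (X N) (\<lambda>x. indicator U x * (\<nu> N x - 1))\<bar> \<le> \<tau>" .
    qed
  qed
  then show ?thesis using T0 by blast
qed

text \<open>At a fixed large N, failure of every partition would allow dual functions to be added
  one after another, each raising the energy by at least \<open>\<gamma>\<close>. As the energy is
  at most 4, this cannot go on for \<open>m > 4 / \<gamma>\<close> rounds.\<close>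

lemma weak_regularity:
  assumes \<epsilon>: "0 < \<epsilon>" "\<epsilon> \<le> 1" and \<delta>: "0 < \<delta>" "\<delta> \<le> 1"
  shows "\<forall>\<^sub>F N in sequentially. \<forall>f. (\<forall>x\<in>X N. 0 \<le> f x \<and> f x \<le> \<nu> N x) \<longrightarrow>
    (\<exists>\<phi> :: 'b \<Rightarrow> int list. avg (X N) (\<lambda>x. indicator (bad_set (X N) \<phi> (\<nu> N) \<delta>) x * \<nu> N x) \<le> \<delta> \<and>
      (\<forall>G\<in>\<D> N. \<bar>avg (X N) (\<lambda>x. residual (X N) \<phi> (\<nu> N) \<delta> f x * G x)\<bar> \<le> \<epsilon>))"
proof -
  define \<gamma> where "\<gamma> = \<epsilon>\<^sup>2 / (32 * (C + 1)\<^sup>2)"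
  have \<gamma>: "0 < \<gamma>" using \<epsilon> C by (auto simp: \<gamma>_def)
  obtain m :: nat where m: "4 / \<gamma> < m" using reals_Archimedean2 by blast
  define \<rho> where "\<rho> = min \<delta> (min (\<epsilon> / (12 * (C + 1))) (\<epsilon>\<^sup>2 / (512 * (C + 1)\<^sup>2)))"
  have \<rho>: "0 < \<rho>" "\<rho> \<le> \<delta>" "\<rho> \<le> \<epsilon> / (12 * (C + 1))" "\<rho> \<le> \<epsilon>\<^sup>2 / (512 * (C + 1)\<^sup>2)"
    using \<delta> \<epsilon> C by (auto simp: \<rho>_def)
  \<comment> \<open>Chosen so that the bound \<open>2 * \<tau> / \<delta> + \<tau>\<close> on the
    mass of the bad set is at most \<open>\<rho>\<close>.\<close>
  define \<tau> where "\<tau> = \<rho> * \<delta> / 3"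
  have \<tau>: "0 < \<tau>" "2 * \<tau> / \<delta> + \<tau> \<le> \<rho>"
    using \<rho> \<delta> mult_left_mono[of \<delta> 1 \<rho>] by (auto simp: \<tau>_def field_simps)
  define \<eta> where "\<eta> = \<epsilon> / 8"
  have \<eta>: "0 < \<eta>" using \<epsilon> by (simp add: \<eta>_def)
  obtain T where T: "0 < T" and ev: "\<forall>\<^sub>F N in sequentially. \<exists>off. \<forall>Gs. length Gs \<le> m \<and> set Gs \<subseteq> \<D> N \<longrightarrow>
    (\<forall>U\<in>saturated_sets (X N) (coloring \<eta> T off Gs). \<bar>avg (X N) (\<lambda>x. indicator U x * (\<nu> N x - 1))\<bar> \<le> \<tau>)"
    using orth_saturated[OF \<tau>(1) \<eta>] by blast
  from ev eventually_avg_le show ?thesis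
  proof eventually_elim
    case (elim N)
    then obtain off where off: "\<And>Gs U. length Gs \<le> m \<Longrightarrow> set Gs \<subseteq> \<D> N \<Longrightarrow>
      U \<in> saturated_sets (X N) (coloring \<eta> T off Gs) \<Longrightarrow> \<bar>avg (X N) (\<lambda>x. indicator U x * (\<nu> N x - 1))\<bar> \<le> \<tau>"
      by blast
    let ?col = "coloring \<eta> T off"
    let ?bad = "\<lambda>Gs. bad_set (X N) (?col Gs) (\<nu> N) \<delta>"
    have bad: "avg (X N) (indicator (?bad Gs)) \<le> \<rho>" "avg (X N) (\<lambda>x. indicator (?bad Gs) x * \<nu> N x) \<le> \<rho>"
      if "length Gs \<le> m" "set Gs \<subseteq> \<D> N" for Gs
      using avg_bad_set[OF finite_X nonempty_X \<delta>(1) off[OF that]] \<tau> by fastforce+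
    show ?case
    proof (intro allI impI, rule ccontr)
      fix f assume f: "\<forall>x\<in>X N. 0 \<le> f x \<and> f x \<le> \<nu> N x"
      assume *: "\<not> (\<exists>\<phi> :: 'b \<Rightarrow> int list. avg (X N) (\<lambda>x. indicator (bad_set (X N) \<phi> (\<nu> N) \<delta>) x * \<nu> N x) \<le> \<delta> \<and>
        (\<forall>G\<in>\<D> N. \<bar>avg (X N) (\<lambda>x. residual (X N) \<phi> (\<nu> N) \<delta> f x * G x)\<bar> \<le> \<epsilon>))"
      have "\<exists>Gs. length Gs = n \<and> set Gs \<subseteq> \<D> N \<and> n * \<gamma> \<le> energy (X N) (?col Gs) (\<nu> N) \<delta> f" if "n \<le> m" for n
        using that
      proof (induction n)
        case 0
        show ?case by (auto simp: energy_def intro!: avg_nonneg simp: indicator_def)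
      next
        case (Suc n)
        then obtain Gs where Gs: "length Gs = n" "set Gs \<subseteq> \<D> N" "n * \<gamma> \<le> energy (X N) (?col Gs) (\<nu> N) \<delta> f"
          by auto
        have "avg (X N) (\<lambda>x. indicator (?bad Gs) x * \<nu> N x) \<le> \<delta>"
          using bad(2)[of Gs] Gs Suc.prems \<rho>(2) by simp
        then obtain G where G: "G \<in> \<D> N" "\<epsilon> < \<bar>avg (X N) (\<lambda>x. residual (X N) (?col Gs) (\<nu> N) \<delta> f x * G x)\<bar>"
          using * not_le by blast
        let ?Gs = "G # Gs"
        have Gs': "length ?Gs \<le> m" "set ?Gs \<subseteq> \<D> N" using Gs G Suc.prems by auto
        have "energy (X N) (?col Gs) (\<nu> N) \<delta> f + \<epsilon>\<^sup>2 / (32 * (C + 1)\<^sup>2) \<le> energy (X N) (?col ?Gs) (\<nu> N) \<delta> f"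
        \<comment> \<open>\<open>G'\<close> is the lower end of the cell of \<open>G\<close>, hence
          a function of the head of the new label.\<close>
        proof (rule energy_increment[where G = G and \<rho> = \<rho>
              and G' = "\<lambda>x. \<eta> * (cell \<eta> T (off G) (G x) - off G / T)"])
          show "\<bar>G x - \<eta> * (cell \<eta> T (off G) (G x) - off G / T)\<bar> \<le> \<epsilon> / 8" for x
            using cell_representative[OF T \<eta>] by (simp add: \<eta>_def)
        qed (use f \<delta> bad[OF Gs'] elim(2) C dual_bound G \<epsilon> \<rho> finite_X nonempty_X in \<open>auto simp: coloring_def\<close>)
        then have "Suc n * \<gamma> \<le> energy (X N) (?col ?Gs) (\<nu> N) \<delta> f"
          using Gs(3) by (simp add: \<gamma>_def[symmetric] distrib_right)
        then show ?case using Gs Gs' by (intro exI[of _ ?Gs]) auto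
      qed
      then obtain Gs where "m * \<gamma> \<le> energy (X N) (?col Gs) (\<nu> N) \<delta> f" by blast
      moreover have "energy (X N) (?col Gs) (\<nu> N) \<delta> f \<le> 4"
        using f \<delta> by (intro energy_le finite_X nonempty_X) auto
      moreover have "4 < m * \<gamma>" using m \<gamma> by (simp add: field_simps)
      ultimately show False by linarith
    qed
  qed
qed

end

section \<open>Averages over product sets\<close>

lemma avg_bij_betw: "bij_betw g A B \<Longrightarrow> avg B h = avg A (\<lambda>x. h (g x))"
  by (simp add: avg_def sum.reindex_bij_betw bij_betw_same_card)

lemma avg_PiE_insert:
  assumes "j \<notin> e"
  shows "avg (PiE (insert j e) Z) h = avg (Z j) (\<lambda>c. avg (PiE e Z) (\<lambda>z. h (z(j := c))))"
proof -
  have "bij_betw (\<lambda>(y, g). g(j := y)) (Z j \<times> PiE e Z) (PiE (insert j e) Z)"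
    by (auto simp: bij_betw_def PiE_insert_eq intro: inj_combinator[OF assms])
  then show ?thesis
    by (simp add: avg_bij_betw avg_Times[symmetric] split_def)
qed

text \<open>Redrawing one coordinate leaves the distribution of a uniform point unchanged. This
  isolates a coordinate before Cauchy-Schwarz is applied.\<close>

lemma avg_PiE_resample:
  assumes "j \<in> e" "finite (Z j)" "Z j \<noteq> {}"
  shows "avg (PiE e Z) h = avg (PiE e Z) (\<lambda>z. avg (Z j) (\<lambda>c. h (z(j := c))))"
proof -
  obtain e' where e: "e = insert j e'" "j \<notin> e'" using assms(1) mk_disjoint_insert by metis
  then show ?thesis using assms
    by (simp add: avg_PiE_insert avg_const avg_swap[of "PiE e' Z"])
qed

text \<open>Maps that preserve the uniform measure coordinate by coordinate preserve it on the
  product, and coordinates outside \<open>e\<close> average out. All later omissions of variables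
  rest on this.\<close>

lemma avg_PiE_map:
  assumes "finite J" "e \<subseteq> J" "\<And>i. i \<in> J \<Longrightarrow> finite (Z i) \<and> Z i \<noteq> {}"
    and "\<And>i g. i \<in> e \<Longrightarrow> avg (Z i) (\<lambda>c. g (\<pi> i c)) = avg (V i) g"
  shows "avg (PiE J Z) (\<lambda>z. h (\<lambda>i\<in>e. \<pi> i (z i))) = avg (PiE e V) h"
  using assms
proof (induction J arbitrary: e h)
  case empty
  then show ?case by (simp add: avg_def restrict_def)
next
  case (insert j J)
  show ?case
  proof (cases "j \<in> e")
    case True
    then obtain e' where e: "e = Set.insert j e'" "j \<notin> e'" by (metis mk_disjoint_insert)
    then have e': "e' \<subseteq> J" using insert.prems insert.hyps by auto
    have "(\<lambda>i\<in>e. \<pi> i ((z(j := c)) i)) = (\<lambda>i\<in>e'. \<pi> i (z i))(j := \<pi> j c)" for z c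
      using e by (auto simp: fun_eq_iff)
    then have "avg (PiE (Set.insert j J) Z) (\<lambda>z. h (\<lambda>i\<in>e. \<pi> i (z i)))
        = avg (Z j) (\<lambda>c. avg (PiE J Z) (\<lambda>z. h ((\<lambda>i\<in>e'. \<pi> i (z i))(j := \<pi> j c))))"
      using insert.hyps by (simp add: avg_PiE_insert)
    also have "\<dots> = avg (Z j) (\<lambda>c. avg (PiE e' V) (\<lambda>y. h (y(j := \<pi> j c))))"
      using insert.prems e
      by (intro avg_cong insert.IH[OF e', where h = "\<lambda>y. h (y(j := \<pi> j _))"]) auto
    also have "\<dots> = avg (PiE e V) h"
      using e insert.prems(3)[of j "\<lambda>c. avg (PiE e' V) (\<lambda>y. h (y(j := c)))"]
      by (simp add: avg_PiE_insert)
    finally show ?thesis .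
  next
    case False
    then have e: "e \<subseteq> J" using insert.prems by auto
    have "(\<lambda>i\<in>e. \<pi> i ((z(j := c)) i)) = (\<lambda>i\<in>e. \<pi> i (z i))" for z c
      using False by (auto simp: fun_eq_iff)
    then have "avg (PiE (Set.insert j J) Z) (\<lambda>z. h (\<lambda>i\<in>e. \<pi> i (z i))) = avg (PiE J Z) (\<lambda>z. h (\<lambda>i\<in>e. \<pi> i (z i)))"
      using insert.hyps insert.prems(2)[of j] by (simp add: avg_PiE_insert avg_const)
    also have "\<dots> = avg (PiE e V) h" using insert.prems e by (intro insert.IH) auto
    finally show ?thesis .
  qed
qed

lemma avg_PiE_pair:
  "avg (PiE e V \<times> PiE e W) (\<lambda>(x, y). h x y)
    = avg (PiE e (\<lambda>i. V i \<times> W i)) (\<lambda>z. h (\<lambda>i\<in>e. fst (z i)) (\<lambda>i\<in>e. snd (z i)))"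
proof -
  have "bij_betw (\<lambda>z. (\<lambda>i\<in>e. fst (z i), \<lambda>i\<in>e. snd (z i))) (PiE e (\<lambda>i. V i \<times> W i)) (PiE e V \<times> PiE e W)"
    by (rule bij_betw_byWitness[where f' = "\<lambda>(x, y). \<lambda>i\<in>e. (x i, y i)"])
      (auto simp: PiE_iff extensional_def restrict_def fun_eq_iff mem_Times_iff)
  from avg_bij_betw[OF this] show ?thesis by simp
qed

lemma avg_PiE_curry:
  "avg (PiE I (\<lambda>_. PiE e V)) h
    = avg (PiE e (\<lambda>i. PiE I (\<lambda>_. V i))) (\<lambda>y. h (\<lambda>k\<in>I. \<lambda>i\<in>e. y i k))"
proof -
  have "bij_betw (\<lambda>y. \<lambda>k\<in>I. \<lambda>i\<in>e. y i k) (PiE e (\<lambda>i. PiE I (\<lambda>_. V i))) (PiE I (\<lambda>_. PiE e V))"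
    by (rule bij_betw_byWitness[where f' = "\<lambda>y. \<lambda>i\<in>e. \<lambda>k\<in>I. y k i"])
      (auto simp: PiE_iff extensional_def restrict_def fun_eq_iff)
  from avg_bij_betw[OF this] show ?thesis by simp
qed

lemma avg_PiE_coord:
  assumes "k \<in> I" "finite I" "finite A" "A \<noteq> {}"
  shows "avg (PiE I (\<lambda>_. A)) (\<lambda>b. g (b k)) = avg A g"
proof -
  have "finite (PiE I (\<lambda>_. A))" "PiE I (\<lambda>_. A) \<noteq> {}" using assms by (auto simp: PiE_eq_empty_iff intro: finite_PiE)
  then show ?thesis
    using avg_PiE_resample[of k I "\<lambda>_. A" "\<lambda>b. g (b k)"] assms by (simp add: avg_const)
qed

lemma avg_prod_PiE:
  assumes "finite I" "finite A"
  shows "avg (PiE I (\<lambda>_. A)) (\<lambda>b. \<Prod>k\<in>I. g k (b k)) = (\<Prod>k\<in>I. avg A (g k))"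
  using assms by (simp add: avg_def card_PiE prod_dividef prod_sum_PiE[symmetric])

lemma avg_mult_avg: "avg A f * avg B g = avg A (\<lambda>x. avg B (\<lambda>y. f x * g y))"
  by (simp add: avg_cmult avg_cmult_right)

section \<open>Correlation with products of dual functions\<close>

lemma prod_Pow_insert:
  fixes g :: "'j set \<Rightarrow> real"
  assumes "finite A" "j \<notin> A"
  shows "(\<Prod>\<sigma>\<in>Pow (insert j A). g \<sigma>) = (\<Prod>\<sigma>\<in>Pow A. g \<sigma> * g (insert j \<sigma>))"
proof -
  have "inj_on (insert j) (Pow A)" using assms by (auto simp: inj_on_def)
  moreover have "Pow A \<inter> insert j ` Pow A = {}" using assms by auto
  ultimately show ?thesis
    using assms by (simp add: Pow_insert prod.union_disjoint prod.reindex prod.distrib)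
qed

lemma prod_Pow_Un:
  fixes g :: "'j set \<Rightarrow> real"
  assumes "finite A" "finite B" "A \<inter> B = {}"
  shows "(\<Prod>\<sigma>\<in>Pow (A \<union> B). g \<sigma>) = (\<Prod>\<theta>\<in>Pow A. \<Prod>\<omega>\<in>Pow B. g (\<theta> \<union> \<omega>))"
  using assms
proof (induction A arbitrary: g)
  case (insert a A)
  then have "(\<Prod>\<sigma>\<in>Pow (insert a (A \<union> B)). g \<sigma>) = (\<Prod>\<sigma>\<in>Pow (A \<union> B). g \<sigma> * g (insert a \<sigma>))"
    by (intro prod_Pow_insert) auto
  also have "\<dots> = (\<Prod>\<theta>\<in>Pow A. \<Prod>\<omega>\<in>Pow B. g (\<theta> \<union> \<omega>) * g (insert a (\<theta> \<union> \<omega>)))"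
    using insert by (intro insert.IH) auto
  also have "\<dots> = (\<Prod>\<theta>\<in>Pow (insert a A). \<Prod>\<omega>\<in>Pow B. g (\<theta> \<union> \<omega>))"
    using insert by (simp add: prod_Pow_insert prod.distrib)
  finally show ?case by simp
qed simp

text \<open>A coordinate \<^term>\<open>(a, a', b)\<close> of a point of \<open>triples\<close> carries the two values of the cube variables and
  the values \<^term>\<open>b k\<close> of the inner variable in the \<open>k\<close>-th dual function, so that all variables live in one product
  space; a variable that does not occur in an integrand is averaged over without effect.\<close>

definition mixpt :: "'j set \<Rightarrow> nat \<Rightarrow> 'j set \<Rightarrow> 'j set \<Rightarrow> ('j \<Rightarrow> 'a \<times> 'a \<times> (nat \<Rightarrow> 'a)) \<Rightarrow> 'j \<Rightarrow> 'a" where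
  "mixpt e k \<theta> \<omega> z = (\<lambda>i\<in>e. if i \<in> \<omega> then snd (snd (z i)) k else if i \<in> \<theta> then fst (snd (z i)) else fst (z i))"

definition triples :: "('j \<Rightarrow> 'a set) \<Rightarrow> nat \<Rightarrow> 'j \<Rightarrow> ('a \<times> 'a \<times> (nat \<Rightarrow> 'a)) set" where
  "triples V K i = V i \<times> V i \<times> PiE {..<K} (\<lambda>_. V i)"

text \<open>The average reached after the coordinates in \<open>S\<close> have been doubled by the Cauchy--Schwarz inequality:
  for \<open>S = {}\<close> it is the correlation of \<open>f\<close> with a product of dual functions, for \<open>S = e\<close> the box integral of \<open>f\<close>.\<close>

definition gowers_stage ::
  "('j \<Rightarrow> 'a set) \<Rightarrow> 'j set \<Rightarrow> (('j \<Rightarrow> 'a) \<Rightarrow> real) \<Rightarrow> nat \<Rightarrow> (nat \<Rightarrow> ('j \<Rightarrow> 'a) \<Rightarrow> real) \<Rightarrow> 'j set \<Rightarrow> real" where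
  "gowers_stage V e f K F S = avg (PiE e (triples V K)) (\<lambda>z. \<Prod>\<theta>\<in>Pow S.
     f (mixpt e 0 \<theta> {} z) * (\<Prod>k<K. \<Prod>\<omega>\<in>Pow (e - S) - {{}}. F k (mixpt e k \<theta> \<omega> z)))"

text \<open>The inner average of condition (iii), for a weight \<open>w\<close>, as a function of
  the other coordinates. The entry of \<open>p\<close> at \<open>j\<close> is overwritten, so
  \<open>p\<close> may range over pairs of points of V_e.\<close>

definition fibre_box :: "('j \<Rightarrow> 'a set) \<Rightarrow> 'j set \<Rightarrow> 'j \<Rightarrow> (('j \<Rightarrow> 'a) \<Rightarrow> real) \<Rightarrow> ('j \<Rightarrow> 'a \<times> 'a) \<Rightarrow> real" where
  "fibre_box V e j w p = avg (V j) (\<lambda>b. avg (V j) (\<lambda>b'. \<Prod>\<sigma>\<in>Pow e.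
     w (\<lambda>i\<in>e. if i \<in> \<sigma> then ((\<lambda>i. snd (p i))(j := b')) i else ((\<lambda>i. fst (p i))(j := b)) i)))"

lemma mixpt_in:
  "z \<in> PiE e (triples V K) \<Longrightarrow> k < K \<or> \<omega> = {} \<Longrightarrow> mixpt e k \<theta> \<omega> z \<in> PiE e V"
  by (fastforce simp: mixpt_def triples_def PiE_iff)

lemma triples_finite:
  assumes "finite (V i)" "V i \<noteq> {}" shows "finite (triples V K i)" "triples V K i \<noteq> {}"
  using assms by (auto simp: triples_def PiE_eq_empty_iff intro!: finite_PiE)

lemma avg_triples: "avg (triples V K i) h = avg (V i) (\<lambda>a. avg (V i) (\<lambda>a'. avg (PiE {..<K} (\<lambda>_. V i)) (\<lambda>b. h (a, a', b))))"
  by (simp add: triples_def avg_Times')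

text \<open>An elementary substitute for Hoelder's inequality: the product is at most the
  \<open>K\<close>-th power of the largest factor. The 1 covers \<open>K = 0\<close>.\<close>

lemma power_prod_le_sum:
  fixes q :: "nat \<Rightarrow> real"
  assumes "\<And>k. k < K \<Longrightarrow> 0 \<le> q k"
  shows "(\<Prod>k<K. q k) \<le> 1 + (\<Sum>k<K. q k ^ K)"
proof (cases "K = 0")
  case False
  define m where "m = Max (q ` {..<K})"
  have "m \<in> q ` {..<K}" unfolding m_def using False by (intro Max_in) auto
  then obtain l where l: "l < K" "m = q l" by auto
  have "(\<Prod>k<K. q k) \<le> (\<Prod>k<K. m)" using assms by (intro prod_mono) (auto simp: m_def)
  also have "\<dots> = q l ^ K" using l by simp
  also have "\<dots> \<le> (\<Sum>k<K. q k ^ K)" using l assms by (intro member_le_sum) auto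
  finally show ?thesis by simp
qed simp

text \<open>At coordinate \<open>j\<close> the integrand splits as
  \<open>\<alpha> * \<beta>\<close>, where \<open>\<alpha>\<close> reads only the first cube value
  and \<open>\<beta>\<close> only the inner values. Averaging over that coordinate separates the
  two. Cauchy-Schwarz in the remaining variables squares the average of \<open>\<alpha>\<close>,
  which amounts to doubling \<open>j\<close>; in the average of \<open>\<beta>\<close> each
  \<open>F k\<close> is dominated by \<open>w\<close> and the inner variables of different
  \<open>k\<close> are independent, so moments of \<open>fibre_box\<close> bound it.\<close>

lemma gowers_stage_step:
  fixes V :: "'j \<Rightarrow> 'a set"
  assumes e: "finite e" "S \<subseteq> e" "j \<in> e" "j \<notin> S"
    and V: "\<And>i. i \<in> e \<Longrightarrow> finite (V i) \<and> V i \<noteq> {}"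
    and F: "\<And>k x. k < K \<Longrightarrow> x \<in> PiE e V \<Longrightarrow> \<bar>F k x\<bar> \<le> w x"
    and M: "avg (PiE e (\<lambda>i. V i \<times> V i)) (\<lambda>p. fibre_box V e j w p ^ K) \<le> M"
  shows "(gowers_stage V e f K F S)\<^sup>2 \<le> gowers_stage V e f K F (insert j S) * (1 + K * M)"
proof -
  let ?Z = "triples V K" and ?m = "\<lambda>k \<theta> \<omega> z. mixpt e k \<theta> \<omega> z"
  define E where "E = e - S - {j}"
  have E: "finite E" "j \<notin> E" "e - S = insert j E" "e - insert j S = E" "S \<inter> E = {}" "finite S" "e = insert j (S \<union> E)"
    using e finite_subset by (auto simp: E_def)
  define \<alpha> where "\<alpha> z = (\<Prod>\<theta>\<in>Pow S. f (?m 0 \<theta> {} z) * (\<Prod>k<K. \<Prod>\<omega>\<in>Pow E - {{}}. F k (?m k \<theta> \<omega> z)))" for z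
  define \<beta> where "\<beta> z = (\<Prod>k<K. \<Prod>\<theta>\<in>Pow S. \<Prod>\<omega>\<in>Pow E. F k (?m k \<theta> (insert j \<omega>) z))" for z
  have \<alpha>_cong: "\<alpha> (z(j := c)) = \<alpha> (z(j := c'))" if "fst c = fst c'" for z c c'
  proof -
    have "?m k \<theta> \<omega> (z(j := c)) = ?m k \<theta> \<omega> (z(j := c'))" if "\<theta> \<subseteq> S" "\<omega> \<subseteq> E" for k \<theta> \<omega>
      using that \<open>fst c = fst c'\<close> e E by (auto simp: mixpt_def fun_eq_iff restrict_def)
    then show ?thesis by (simp add: \<alpha>_def)
  qed
  have \<beta>_cong: "\<beta> (z(j := c)) = \<beta> (z(j := c'))" if "snd (snd c) = snd (snd c')" for z c c'
  proof -
    have "?m k \<theta> (insert j \<omega>) (z(j := c)) = ?m k \<theta> (insert j \<omega>) (z(j := c'))" for k \<theta> \<omega>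
      using that by (auto simp: mixpt_def fun_eq_iff restrict_def)
    then show ?thesis by (simp add: \<beta>_def)
  qed
  define A where "A z a = \<alpha> (z(j := (a, fst (snd (z j)), snd (snd (z j)))))" for z a
  define B where "B z b = \<beta> (z(j := (fst (z j), fst (snd (z j)), b)))" for z b
  have A: "\<alpha> (z(j := (a, c))) = A z a" for z a c unfolding A_def by (rule \<alpha>_cong) simp
  have B: "\<beta> (z(j := (a, a', b))) = B z b" for z a a' b unfolding B_def by (rule \<beta>_cong) simp
  let ?W = "PiE {..<K} (\<lambda>_. V j)"
  have Vj: "finite (V j)" "V j \<noteq> {}" using V e by auto
  have W: "finite ?W" "?W \<noteq> {}" using Vj by (auto simp: PiE_eq_empty_iff intro!: finite_PiE)
  note Zj = triples_finite[of V j K, OF Vj]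
  have sq: "avg (PiE e ?Z) (\<lambda>z. (avg (V j) (A z))\<^sup>2) = gowers_stage V e f K F (insert j S)"
  proof -
    have "gowers_stage V e f K F (insert j S) = avg (PiE e ?Z) (\<lambda>z. \<alpha> z * \<alpha> (z(j := (fst (snd (z j)), snd (z j)))))"
      unfolding gowers_stage_def E(4)
    proof (rule avg_cong)
      fix z :: "'j \<Rightarrow> 'a \<times> 'a \<times> (nat \<Rightarrow> 'a)"
      let ?z = "z(j := (fst (snd (z j)), snd (z j)))"
      \<comment> \<open>Moving the second cube value at \<open>j\<close> into first place has the
        effect of adding \<open>j\<close> to \<open>\<theta>\<close>.\<close>
      have "?m k \<theta> \<omega> ?z = ?m k (insert j \<theta>) \<omega> z" if "\<theta> \<subseteq> S" "\<omega> \<subseteq> E" for k \<theta> \<omega>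
        using that e E by (auto simp: mixpt_def fun_eq_iff restrict_def)
      then show "(\<Prod>\<theta>\<in>Pow (insert j S). f (?m 0 \<theta> {} z) * (\<Prod>k<K. \<Prod>\<omega>\<in>Pow E - {{}}. F k (?m k \<theta> \<omega> z))) = \<alpha> z * \<alpha> ?z"
        using E e by (simp add: \<alpha>_def prod_Pow_insert prod.distrib)
    qed
    also have "\<dots> = avg (PiE e ?Z) (\<lambda>z. (avg (V j) (A z))\<^sup>2)"
      by (subst avg_PiE_resample[OF e(3)])
        (simp_all add: Zj avg_triples A avg_const W avg_mult_avg power2_eq_square)
    finally show ?thesis by simp
  qed
  have "gowers_stage V e f K F S = avg (PiE e ?Z) (\<lambda>z. \<alpha> z * \<beta> z)"
    unfolding gowers_stage_def
  proof (rule avg_cong)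
    fix z :: "'j \<Rightarrow> 'a \<times> 'a \<times> (nat \<Rightarrow> 'a)"
    \<comment> \<open>The nonempty \<open>\<omega>\<close> that avoid \<open>j\<close> go to
      \<open>\<alpha>\<close>; those that contain \<open>j\<close> go to
      \<open>\<beta>\<close>.\<close>
    have P: "Pow (insert j E) - {{}} = (Pow E - {{}}) \<union> insert j ` Pow E" "(Pow E - {{}}) \<inter> insert j ` Pow E = {}"
      "inj_on (insert j) (Pow E)"
      using E by (auto simp: Pow_insert inj_on_def)
    have "(\<Prod>\<omega>\<in>Pow (e - S) - {{}}. F k (?m k \<theta> \<omega> z)) =
        (\<Prod>\<omega>\<in>Pow E - {{}}. F k (?m k \<theta> \<omega> z)) * (\<Prod>\<omega>\<in>Pow E. F k (?m k \<theta> (insert j \<omega>) z))" for k \<theta>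
      unfolding E(3) P(1) using P E by (subst prod.union_disjoint) (auto simp: prod.reindex)
    then show "(\<Prod>\<theta>\<in>Pow S. f (?m 0 \<theta> {} z) * (\<Prod>k<K. \<Prod>\<omega>\<in>Pow (e - S) - {{}}. F k (?m k \<theta> \<omega> z))) = \<alpha> z * \<beta> z"
      by (simp add: \<alpha>_def \<beta>_def prod.distrib prod.swap[of _ "Pow S"] mult.assoc)
  qed
  also have "\<dots> = avg (PiE e ?Z) (\<lambda>z. avg (V j) (A z) * avg ?W (B z))"
    by (subst avg_PiE_resample[OF e(3)]) (simp_all add: Zj avg_triples A B avg_const Vj avg_mult_avg)
  finally have "(gowers_stage V e f K F S)\<^sup>2
      \<le> avg (PiE e ?Z) (\<lambda>z. (avg (V j) (A z))\<^sup>2) * avg (PiE e ?Z) (\<lambda>z. (avg ?W (B z))\<^sup>2)"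
    by (simp add: avg_Cauchy_Schwarz)
  also have "avg (PiE e ?Z) (\<lambda>z. (avg (V j) (A z))\<^sup>2) = gowers_stage V e f K F (insert j S)"
    by (rule sq)
  also have "\<dots> * avg (PiE e ?Z) (\<lambda>z. (avg ?W (B z))\<^sup>2) \<le> \<dots> * (1 + K * M)"
  proof (rule mult_left_mono)
    \<comment> \<open>Coordinates in \<open>S\<close> read the two cube values, those in
      \<open>E\<close> the first cube value and the \<open>k\<close>-th inner value: two independent
      uniform values in either case, so \<open>?p k z\<close> is a uniform pair of points.\<close>
    let ?p = "\<lambda>k z. \<lambda>i\<in>e. (fst (z i), if i \<in> S then fst (snd (z i)) else snd (snd (z i)) k)"
    define R where "R z k b = (\<Prod>\<theta>\<in>Pow S. \<Prod>\<omega>\<in>Pow E. w (?m k \<theta> (insert j \<omega>) (z(j := (fst (z j), fst (snd (z j)), \<lambda>_. b)))))" for z k b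
    have w0: "0 \<le> w x" if "k < K" "x \<in> PiE e V" for x k
      using F[OF that] by linarith
    have upd: "z(j := (fst (z j), fst (snd (z j)), b)) \<in> PiE e ?Z" if "z \<in> PiE e ?Z" "b \<in> ?W" for z b
      using that e by (auto simp: PiE_iff triples_def extensional_def)
    have upd': "?m k \<theta> (insert j \<omega>) (z(j := (fst (z j), fst (snd (z j)), \<lambda>_. b))) \<in> PiE e V"
      if "z \<in> PiE e ?Z" "b \<in> V j" "k < K" for z b k \<theta> \<omega>
      using that e by (fastforce simp: PiE_iff triples_def extensional_def mixpt_def)
    have R0: "0 \<le> R z k b" if "z \<in> PiE e ?Z" "b \<in> V j" "k < K" for z b k
      unfolding R_def by (intro prod_nonneg ballI w0[OF that(3)] upd' that)
    \<comment> \<open>The square of the average over \<open>b\<close> introduces a second copy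
      \<open>b'\<close>: subsets of \<open>e\<close> without \<open>j\<close> receive
      \<open>b\<close>, those with \<open>j\<close> receive \<open>b'\<close>.\<close>
    have RQ: "(avg (V j) (R z k))\<^sup>2 = fibre_box V e j w (?p k z)" for z k
    proof -
      have "R z k b * R z k b' = (\<Prod>\<sigma>\<in>Pow e.
        w (\<lambda>i\<in>e. if i \<in> \<sigma> then ((\<lambda>i. snd (?p k z i))(j := b')) i else ((\<lambda>i. fst (?p k z i))(j := b)) i))" for b b'
      proof -
        define g where "g \<sigma> = w (\<lambda>i\<in>e. if i \<in> \<sigma> then ((\<lambda>i. snd (?p k z i))(j := b')) i else ((\<lambda>i. fst (?p k z i))(j := b)) i)" for \<sigma>
        have g: "g (\<theta> \<union> \<omega>) = w (?m k \<theta> (insert j \<omega>) (z(j := (fst (z j), fst (snd (z j)), \<lambda>_. b))))"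
          "g (insert j (\<theta> \<union> \<omega>)) = w (?m k \<theta> (insert j \<omega>) (z(j := (fst (z j), fst (snd (z j)), \<lambda>_. b'))))"
          if "\<theta> \<in> Pow S" "\<omega> \<in> Pow E" for \<theta> \<omega>
        proof -
          have j: "j \<notin> \<theta>" "j \<notin> \<omega>" using that e E by auto
          have cases: "i = j \<or> i \<in> S \<and> i \<notin> \<omega> \<and> i \<noteq> j \<or> i \<notin> S \<and> i \<notin> \<theta> \<and> i \<noteq> j" for i
            using that E(5) by auto
          have "(\<lambda>i\<in>e. if i \<in> \<theta> \<union> \<omega> then ((\<lambda>i. snd (?p k z i))(j := b')) i else ((\<lambda>i. fst (?p k z i))(j := b)) i)
              = ?m k \<theta> (insert j \<omega>) (z(j := (fst (z j), fst (snd (z j)), \<lambda>_. b)))"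
            unfolding mixpt_def
          proof (rule restrict_ext, goal_cases)
            case (1 i)
            then show ?case using cases[of i] j by (elim disjE conjE) simp_all
          qed
          then show "g (\<theta> \<union> \<omega>) = w (?m k \<theta> (insert j \<omega>) (z(j := (fst (z j), fst (snd (z j)), \<lambda>_. b))))"
            by (simp only: g_def)
          have "(\<lambda>i\<in>e. if i \<in> insert j (\<theta> \<union> \<omega>) then ((\<lambda>i. snd (?p k z i))(j := b')) i else ((\<lambda>i. fst (?p k z i))(j := b)) i)
              = ?m k \<theta> (insert j \<omega>) (z(j := (fst (z j), fst (snd (z j)), \<lambda>_. b')))"
            unfolding mixpt_def
          proof (rule restrict_ext, goal_cases)
            case (1 i)
            then show ?case using cases[of i] j by (elim disjE conjE) simp_all
          qed
          then show "g (insert j (\<theta> \<union> \<omega>)) = w (?m k \<theta> (insert j \<omega>) (z(j := (fst (z j), fst (snd (z j)), \<lambda>_. b'))))"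
            by (simp only: g_def)
        qed
        have "(\<Prod>\<sigma>\<in>Pow (insert j (S \<union> E)). g \<sigma>) = (\<Prod>\<sigma>\<in>Pow (S \<union> E). g \<sigma> * g (insert j \<sigma>))"
          using E e by (intro prod_Pow_insert) auto
        also have "\<dots> = (\<Prod>\<theta>\<in>Pow S. \<Prod>\<omega>\<in>Pow E. g (\<theta> \<union> \<omega>) * g (insert j (\<theta> \<union> \<omega>)))"
          using E by (intro prod_Pow_Un) auto
        also have "\<dots> = R z k b * R z k b'" by (simp add: R_def g prod.distrib)
        finally show ?thesis by (simp only: g_def E(7)[symmetric])
      qed
      then show ?thesis by (simp add: power2_eq_square avg_mult_avg fibre_box_def)
    qed
    have "avg (PiE e ?Z) (\<lambda>z. (avg ?W (B z))\<^sup>2) \<le> avg (PiE e ?Z) (\<lambda>z. 1 + (\<Sum>k<K. fibre_box V e j w (?p k z) ^ K))"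
    proof (rule avg_mono)
      fix z assume z: "z \<in> PiE e ?Z"
      have "\<bar>avg ?W (B z)\<bar> \<le> avg ?W (\<lambda>b. \<Prod>k\<in>{..<K}. R z k (b k))"
      proof (rule avg_abs_mono)
        fix b assume b: "b \<in> ?W"
        have "\<bar>F k (?m k \<theta> (insert j \<omega>) (z(j := (fst (z j), fst (snd (z j)), b))))\<bar>
            \<le> w (?m k \<theta> (insert j \<omega>) (z(j := (fst (z j), fst (snd (z j)), \<lambda>_. b k))))" if "k < K" for k \<theta> \<omega>
        proof -
          have "?m k \<theta> (insert j \<omega>) (z(j := (fst (z j), fst (snd (z j)), \<lambda>_. b k)))
              = ?m k \<theta> (insert j \<omega>) (z(j := (fst (z j), fst (snd (z j)), b)))"
            by (auto simp: mixpt_def fun_eq_iff restrict_def)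
          then show ?thesis using F[OF that mixpt_in[OF upd[OF z b]]] that by simp
        qed
        then show "\<bar>B z b\<bar> \<le> (\<Prod>k\<in>{..<K}. R z k (b k))"
          unfolding B_def \<beta>_def R_def abs_prod by (intro prod_mono conjI prod_nonneg ballI) auto
      qed
      also have "\<dots> = (\<Prod>k\<in>{..<K}. avg (V j) (R z k))" by (rule avg_prod_PiE) (use Vj in auto)
      finally have "\<bar>avg ?W (B z)\<bar>\<^sup>2 \<le> (\<Prod>k\<in>{..<K}. avg (V j) (R z k))\<^sup>2" by (rule power_mono) simp
      also have "\<dots> = (\<Prod>k<K. fibre_box V e j w (?p k z))" by (simp only: prod_power_distrib RQ)
      also have "\<dots> \<le> 1 + (\<Sum>k<K. fibre_box V e j w (?p k z) ^ K)"
        by (rule power_prod_le_sum) (simp add: RQ[symmetric])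
      finally show "(avg ?W (B z))\<^sup>2 \<le> 1 + (\<Sum>k<K. fibre_box V e j w (?p k z) ^ K)" by simp
    qed
    also have "\<dots> = 1 + (\<Sum>k<K. avg (PiE e ?Z) (\<lambda>z. fibre_box V e j w (?p k z) ^ K))"
      using V e by (simp add: avg_add avg_sum avg_const PiE_eq_empty_iff finite_PiE triples_finite)
    also have "\<dots> = 1 + (\<Sum>k<K. avg (PiE e (\<lambda>i. V i \<times> V i)) (\<lambda>p. fibre_box V e j w p ^ K))"
    proof (intro arg_cong2[of _ _ _ _ "(+)"] sum.cong refl avg_PiE_map[OF e(1) subset_refl])
      fix i k g assume i: "i \<in> e" and "k \<in> {..<K}"
      then have k: "k < K" by simp
      have Vi: "finite (V i)" "V i \<noteq> {}" using V i by auto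
      have Wi: "finite (PiE {..<K} (\<lambda>_. V i))" "PiE {..<K} (\<lambda>_. V i) \<noteq> {}"
        using Vi by (auto simp: PiE_eq_empty_iff intro!: finite_PiE)
      have g: "avg (V i \<times> V i) g = avg (V i) (\<lambda>a. avg (V i) (\<lambda>b. g (a, b)))"
        by (rule avg_Times')
      show "avg (?Z i) (\<lambda>c. g (fst c, if i \<in> S then fst (snd c) else snd (snd c) k)) = avg (V i \<times> V i) g"
        using avg_PiE_coord[of k "{..<K}" "V i" "\<lambda>b. g (_, b)"] Vi k
        by (cases "i \<in> S") (simp_all add: g avg_triples avg_const[OF Wi] avg_const[OF Vi])
    qed (use V triples_finite[of V _ K] in auto)
    also have "\<dots> \<le> 1 + (\<Sum>k<K. M)" using M by (intro add_left_mono sum_mono)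
    finally show "avg (PiE e ?Z) (\<lambda>z. (avg ?W (B z))\<^sup>2) \<le> 1 + K * M" by simp
  next
    show "0 \<le> gowers_stage V e f K F (insert j S)"
      unfolding sq[symmetric] by (rule avg_nonneg) simp
  qed
  finally show ?thesis .
qed

text \<open>Each Cauchy-Schwarz step squares the estimate so far and adds one factor
  \<open>1 + K * M\<close>, so its exponent passes from n - 1 to 2(n - 1) + 1 = 2n - 1.\<close>

lemma gowers_stage_chain:
  fixes V :: "'j \<Rightarrow> 'a set"
  assumes e: "finite e" "S \<subseteq> e" and V: "\<And>i. i \<in> e \<Longrightarrow> finite (V i) \<and> V i \<noteq> {}"
    and F: "\<And>k x. k < K \<Longrightarrow> x \<in> PiE e V \<Longrightarrow> \<bar>F k x\<bar> \<le> w x"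
    and M: "0 \<le> M" "\<And>j. j \<in> e \<Longrightarrow> avg (PiE e (\<lambda>i. V i \<times> V i)) (\<lambda>p. fibre_box V e j w p ^ K) \<le> M"
  shows "\<bar>gowers_stage V e f K F {}\<bar> ^ 2 ^ card S \<le> (1 + K * M) ^ (2 ^ card S - 1) * \<bar>gowers_stage V e f K F S\<bar>"
proof -
  have "finite S" using e finite_subset by blast
  then show ?thesis using e(2)
  proof (induction S)
    case (insert j S)
    define D where "D = 1 + K * M"
    have D: "1 \<le> D" using M by (simp add: D_def)
    let ?g = "\<lambda>S. \<bar>gowers_stage V e f K F S\<bar>" and ?n = "2 ^ card S :: nat"
    have n: "1 \<le> ?n" by simp
    have "?g {} ^ (2 * ?n) = (?g {} ^ ?n)\<^sup>2" by (simp add: power_mult[symmetric] mult.commute)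
    also have "\<dots> \<le> (D ^ (?n - 1) * ?g S)\<^sup>2"
      using insert by (intro power_mono) (auto simp: D_def)
    also have "\<dots> = D ^ (2 * (?n - 1)) * (gowers_stage V e f K F S)\<^sup>2"
      by (simp add: power_mult_distrib power_mult[symmetric] mult.commute)
    also have "\<dots> \<le> D ^ (2 * (?n - 1)) * (gowers_stage V e f K F (insert j S) * D)"
      unfolding D_def using insert D e V F M(2)[of j]
      by (intro mult_left_mono gowers_stage_step[where w = w]) (auto simp: D_def)
    also have "\<dots> \<le> D ^ (2 * (?n - 1)) * (?g (insert j S) * D)"
      using D by (intro mult_left_mono mult_right_mono) auto
    also have "\<dots> = D ^ (2 * ?n - 1) * ?g (insert j S)"
    proof -
      have "2 * ?n - 1 = Suc (2 * (?n - 1))" using n by linarith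
      then show ?thesis by simp
    qed
    finally show ?case using insert by (simp add: D_def)
  qed simp
qed

section \<open>Cube products as products over subsets, and the two end stages\<close>

lemma cubes_bij: "bij_betw (\<lambda>\<omega>. {i \<in> e. \<omega> i}) (cubes e) (Pow e)"
  by (rule bij_betw_byWitness[where f' = "\<lambda>A. restrict (\<lambda>i. i \<in> A) e"])
    (auto simp: cubes_def PiE_iff extensional_def restrict_def fun_eq_iff)

lemma cubes_bij_nonzero:
  "bij_betw (\<lambda>\<omega>. {i \<in> e. \<omega> i}) (cubes e - {zero_cube e}) (Pow e - {{}})"
proof -
  let ?f = "\<lambda>\<omega>. {i \<in> e. \<omega> i}"
  have z: "zero_cube e \<in> cubes e" "?f (zero_cube e) = {}"
    by (auto simp: cubes_def zero_cube_def)
  have f: "inj_on ?f (cubes e)" "?f ` cubes e = Pow e"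
    using cubes_bij[of e] by (simp_all add: bij_betw_def)
  have "?f ` (cubes e - {zero_cube e}) = ?f ` cubes e - ?f ` {zero_cube e}"
    by (rule inj_on_image_set_diff[OF f(1)]) (use z in auto)
  also have "\<dots> = Pow e - {{}}" by (simp only: f(2) z(2) image_insert image_empty)
  finally have "?f ` (cubes e - {zero_cube e}) = Pow e - {{}}" .
  then show ?thesis using bij_betw_subset[OF cubes_bij, of "cubes e - {zero_cube e}"] by simp
qed

lemma cpt_eq: "cpt e x0 x1 \<omega> = (\<lambda>i\<in>e. if i \<in> {i \<in> e. \<omega> i} then x1 i else x0 i)"
  by (auto simp: cpt_def restrict_def fun_eq_iff)

lemma prod_cubes:
  "(\<Prod>\<omega>\<in>cubes e. g (cpt e x0 x1 \<omega>)) = (\<Prod>A\<in>Pow e. g (\<lambda>i\<in>e. if i \<in> A then x1 i else x0 i))"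
  unfolding cpt_eq by (rule prod.reindex_bij_betw[OF cubes_bij])

lemma prod_cubes_nonzero:
  "(\<Prod>\<omega>\<in>cubes e - {zero_cube e}. g (cpt e x0 x1 \<omega>))
    = (\<Prod>A\<in>Pow e - {{}}. g (\<lambda>i\<in>e. if i \<in> A then x1 i else x0 i))"
  unfolding cpt_eq by (rule prod.reindex_bij_betw[OF cubes_bij_nonzero])

lemma finite_cubes: "finite e \<Longrightarrow> finite (cubes e)"
  by (simp add: cubes_def finite_PiE)

lemma cpt_in: "x0 \<in> VE V e \<Longrightarrow> x1 \<in> VE V e \<Longrightarrow> cpt e x0 x1 \<omega> \<in> VE V e"
  by (auto simp: cpt_def VE_def)

lemma finite_VE:
  "finite e \<Longrightarrow> (\<And>i. i \<in> e \<Longrightarrow> finite (V i) \<and> V i \<noteq> {}) \<Longrightarrow> finite (VE V e) \<and> VE V e \<noteq> {}"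
  by (auto simp: VE_def PiE_eq_empty_iff intro!: finite_PiE)

text \<open>For \<open>S = {}\<close> the second cube values do not occur and are dropped. The inner
  variables of different \<open>k\<close> are independent, so their joint average factors into the
  dual functions.\<close>

lemma gowers_stage_empty:
  fixes V :: "'j \<Rightarrow> 'a set"
  assumes e: "finite e" and V: "\<And>i. i \<in> e \<Longrightarrow> finite (V i) \<and> V i \<noteq> {}"
  shows "gowers_stage V e f K F {} = avg (VE V e) (\<lambda>x. f x * (\<Prod>k<K. Dop V e (F k) x))"
proof -
  let ?W = "\<lambda>i. PiE {..<K} (\<lambda>_. V i)"
  let ?pt = "\<lambda>\<omega> x y. \<lambda>i\<in>e. if i \<in> \<omega> then y i else x i"
  define h :: "('j \<Rightarrow> 'a \<times> (nat \<Rightarrow> 'a)) \<Rightarrow> real" where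
    "h p = f (\<lambda>i\<in>e. fst (p i)) * (\<Prod>k<K. \<Prod>\<omega>\<in>Pow e - {{}}. F k (?pt \<omega> (\<lambda>i. fst (p i)) (\<lambda>i. snd (p i) k)))" for p
  have fin: "finite (PiE e V)" using e V by (simp add: finite_PiE)
  have "gowers_stage V e f K F {} = avg (PiE e (triples V K)) (\<lambda>z. h (\<lambda>i\<in>e. (fst (z i), snd (snd (z i)))))"
    unfolding gowers_stage_def h_def mixpt_def
    by (intro avg_cong) (simp cong: restrict_cong if_cong)
  also have "\<dots> = avg (PiE e (\<lambda>i. V i \<times> ?W i)) h"
  proof (rule avg_PiE_map[OF e subset_refl])
    fix i g assume "i \<in> e"
    then have "finite (V i)" "V i \<noteq> {}" using V by auto
    then show "avg (triples V K i) (\<lambda>c. g (fst c, snd (snd c))) = avg (V i \<times> ?W i) g"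
      by (simp add: avg_triples avg_Times' avg_const)
  qed (use V triples_finite[of V _ K] in auto)
  also have "\<dots> = avg (PiE e (\<lambda>i. V i \<times> ?W i)) (\<lambda>z. (\<lambda>x y. f x *
      (\<Prod>k<K. \<Prod>\<omega>\<in>Pow e - {{}}. F k (?pt \<omega> x (\<lambda>i. y i k)))) (\<lambda>i\<in>e. fst (z i)) (\<lambda>i\<in>e. snd (z i)))"
    unfolding h_def
    by (intro avg_cong) (simp cong: restrict_cong if_cong)
  also have "\<dots> = avg (PiE e V \<times> PiE e ?W) (\<lambda>(x, y). f x *
      (\<Prod>k<K. \<Prod>\<omega>\<in>Pow e - {{}}. F k (?pt \<omega> x (\<lambda>i. y i k))))"
    by (rule avg_PiE_pair[symmetric])
  also have "\<dots> = avg (PiE e V) (\<lambda>x. f x * avg (PiE e ?W) (\<lambda>y.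
      \<Prod>k<K. \<Prod>\<omega>\<in>Pow e - {{}}. F k (?pt \<omega> x (\<lambda>i. y i k))))"
    by (simp add: avg_Times avg_cmult)
  also have "\<dots> = avg (PiE e V) (\<lambda>x. f x * (\<Prod>k<K. Dop V e (F k) x))"
  proof (intro avg_cong arg_cong2[of _ _ _ _ "(*)"] refl)
    fix x
    have "avg (PiE e ?W) (\<lambda>y. \<Prod>k<K. \<Prod>\<omega>\<in>Pow e - {{}}. F k (?pt \<omega> x (\<lambda>i. y i k)))
      = avg (PiE e ?W) (\<lambda>y. (\<lambda>Y. \<Prod>k<K. \<Prod>\<omega>\<in>Pow e - {{}}. F k (?pt \<omega> x (Y k))) (\<lambda>k\<in>{..<K}. \<lambda>i\<in>e. y i k))"
      by (intro avg_cong) (simp cong: restrict_cong if_cong)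
    also have "\<dots> = avg (PiE {..<K} (\<lambda>_. PiE e V)) (\<lambda>Y. \<Prod>k<K. \<Prod>\<omega>\<in>Pow e - {{}}. F k (?pt \<omega> x (Y k)))"
      by (rule avg_PiE_curry[symmetric])
    also have "\<dots> = (\<Prod>k<K. avg (PiE e V) (\<lambda>y. \<Prod>\<omega>\<in>Pow e - {{}}. F k (?pt \<omega> x y)))"
      by (rule avg_prod_PiE) (use fin in auto)
    finally show "avg (PiE e ?W) (\<lambda>y. \<Prod>k<K. \<Prod>\<omega>\<in>Pow e - {{}}. F k (?pt \<omega> x (\<lambda>i. y i k))) = (\<Prod>k<K. Dop V e (F k) x)"
      by (simp add: Dop_def VE_def prod_cubes_nonzero)
  qed
  finally show ?thesis by (simp add: VE_def)
qed

text \<open>For \<open>S = e\<close> no nonempty \<open>\<omega>\<close> is left, so the functions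
  \<open>F k\<close> have disappeared and only the cube values are read.\<close>

lemma gowers_stage_full:
  fixes V :: "'j \<Rightarrow> 'a set"
  assumes e: "finite e" and V: "\<And>i. i \<in> e \<Longrightarrow> finite (V i) \<and> V i \<noteq> {}"
  shows "gowers_stage V e f K F e = avg (VE V e \<times> VE V e) (\<lambda>(x0, x1). \<Prod>\<omega>\<in>cubes e. f (cpt e x0 x1 \<omega>))"
proof -
  define h where "h p = (\<Prod>\<theta>\<in>Pow e. f (\<lambda>i\<in>e. if i \<in> \<theta> then snd (p i) else fst (p i)))" for p :: "'j \<Rightarrow> 'a \<times> 'a"
  have "gowers_stage V e f K F e = avg (PiE e (triples V K)) (\<lambda>z. h (\<lambda>i\<in>e. (fst (z i), fst (snd (z i)))))"
    unfolding gowers_stage_def h_def mixpt_def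
    by (intro avg_cong) (simp cong: restrict_cong if_cong)
  also have "\<dots> = avg (PiE e (\<lambda>i. V i \<times> V i)) h"
  proof (rule avg_PiE_map[OF e subset_refl])
    fix i g assume "i \<in> e"
    then have V: "finite (V i)" "V i \<noteq> {}" using V by auto
    then have "finite (PiE {..<K} (\<lambda>_. V i))" "PiE {..<K} (\<lambda>_. V i) \<noteq> {}"
      by (auto simp: PiE_eq_empty_iff intro!: finite_PiE)
    then show "avg (triples V K i) (\<lambda>c. g (fst c, fst (snd c))) = avg (V i \<times> V i) g"
      by (simp add: avg_triples avg_Times' avg_const)
  qed (use V triples_finite[of V _ K] in auto)
  also have "\<dots> = avg (PiE e (\<lambda>i. V i \<times> V i)) (\<lambda>z. (\<lambda>x0 x1. \<Prod>\<theta>\<in>Pow e. f (\<lambda>i\<in>e. if i \<in> \<theta> then x1 i else x0 i))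
      (\<lambda>i\<in>e. fst (z i)) (\<lambda>i\<in>e. snd (z i)))"
    unfolding h_def by (intro avg_cong) (simp cong: restrict_cong if_cong)
  also have "\<dots> = avg (PiE e V \<times> PiE e V) (\<lambda>(x0, x1). \<Prod>\<theta>\<in>Pow e. f (\<lambda>i\<in>e. if i \<in> \<theta> then x1 i else x0 i))"
    by (rule avg_PiE_pair[symmetric])
  finally show ?thesis by (simp add: VE_def prod_cubes)
qed

lemma avg_dual_prod_le:
  fixes V :: "'j \<Rightarrow> 'a set"
  assumes e: "finite e" and V: "\<And>i. i \<in> e \<Longrightarrow> finite (V i) \<and> V i \<noteq> {}"
    and F: "\<And>k x. k < K \<Longrightarrow> x \<in> VE V e \<Longrightarrow> \<bar>F k x\<bar> \<le> w x"
    and M: "0 \<le> M" "\<And>j. j \<in> e \<Longrightarrow> avg (PiE e (\<lambda>i. V i \<times> V i)) (\<lambda>p. fibre_box V e j w p ^ K) \<le> M"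
  shows "\<bar>avg (VE V e) (\<lambda>x. f x * (\<Prod>k<K. Dop V e (F k) x))\<bar> ^ 2 ^ card e
    \<le> (1 + K * M) ^ (2 ^ card e - 1) * \<bar>avg (VE V e \<times> VE V e) (\<lambda>(x0, x1). \<Prod>\<omega>\<in>cubes e. f (cpt e x0 x1 \<omega>))\<bar>"
  using gowers_stage_chain[where f = f, OF e subset_refl V F M]
  by (simp add: gowers_stage_empty[OF e V] gowers_stage_full[OF e V] VE_def)

section \<open>Pseudorandomness conditions for the shifted weights\<close>

lemma prod_add_one:
  fixes g :: "'b \<Rightarrow> real"
  assumes "finite A"
  shows "(\<Prod>x\<in>A. g x + c) = (\<Sum>T\<in>Pow A. c ^ card (A - T) * (\<Prod>x\<in>A. if x \<in> T then g x else 1))"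
proof -
  have "(\<Prod>x\<in>T. g x) = (\<Prod>x\<in>A. if x \<in> T then g x else 1)" if "T \<in> Pow A" for T
    using that assms by (auto simp: prod.If_cases intro!: prod.cong)
  then show ?thesis using assms by (simp add: prod_add mult.commute)
qed

lemma sum_power_le:
  fixes q :: "'b \<Rightarrow> real"
  assumes "finite I" "I \<noteq> {}" "\<And>i. i \<in> I \<Longrightarrow> 0 \<le> q i"
  shows "(\<Sum>i\<in>I. q i) ^ K \<le> real (card I) ^ K * (\<Sum>i\<in>I. q i ^ K)"
proof -
  define m where "m = Max (q ` I)"
  have "m \<in> q ` I" unfolding m_def using assms by (intro Max_in) auto
  then obtain l where l: "l \<in> I" "m = q l" by auto
  have "(\<Sum>i\<in>I. q i) \<le> (\<Sum>i\<in>I. m)" using assms by (intro sum_mono) (auto simp: m_def)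
  then have "(\<Sum>i\<in>I. q i) ^ K \<le> (card I * m) ^ K" using assms by (intro power_mono sum_nonneg) auto
  also have "\<dots> = real (card I) ^ K * q l ^ K" using l by (simp add: power_mult_distrib)
  also have "\<dots> \<le> real (card I) ^ K * (\<Sum>i\<in>I. q i ^ K)"
    using l assms by (intro mult_left_mono member_le_sum) auto
  finally show ?thesis .
qed

text \<open>Expanding \<open>\<nu> + 1\<close> over the cube gives the products with exponents 0 and
  1 of condition (iii). As the entry of \<open>p\<close> at \<open>j\<close> is overwritten,
  averaging over it as well changes nothing.\<close>

lemma avg_fibre_box_le:
  fixes V :: "'j \<Rightarrow> 'a set" and \<nu> :: "('j \<Rightarrow> 'a) \<Rightarrow> real" and K :: nat
  assumes e: "finite e" "j \<in> e" and V: "\<And>i. i \<in> e \<Longrightarrow> finite (V i) \<and> V i \<noteq> {}"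
    and \<nu>: "\<And>x. x \<in> VE V e \<Longrightarrow> 0 \<le> \<nu> x"
  defines "Q \<equiv> \<lambda>T. avg (VE V (e - {j}) \<times> VE V (e - {j}))
           (\<lambda>(x0, x1). (avg (V j \<times> V j)
              (\<lambda>(y0, y1). \<Prod>\<omega>\<in>cubes e.
                 (if \<omega> \<in> T then \<nu> (cpt e (x0(j := y0)) (x1(j := y1)) \<omega>) else 1))) ^ K)"
  shows "avg (PiE e (\<lambda>i. V i \<times> V i)) (\<lambda>p. fibre_box V e j (\<lambda>x. \<nu> x + 1) p ^ K)
    \<le> real (card (Pow (cubes e))) ^ K * (\<Sum>T\<in>Pow (cubes e). Q T)"
proof -
  define q where "q T p = avg (V j \<times> V j) (\<lambda>(y0, y1). \<Prod>\<omega>\<in>cubes e.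
      if \<omega> \<in> T then \<nu> (cpt e ((\<lambda>i. fst (p i))(j := y0)) ((\<lambda>i. snd (p i))(j := y1)) \<omega>) else 1)"
    for T and p :: "'j \<Rightarrow> 'a \<times> 'a"
  have "fibre_box V e j (\<lambda>x. \<nu> x + 1) p = (\<Sum>T\<in>Pow (cubes e). q T p)" for p
    unfolding fibre_box_def prod_cubes[symmetric, where g = "\<lambda>x. \<nu> x + 1"] prod_add_one[OF finite_cubes[OF e(1)]]
    by (simp add: q_def avg_Times avg_sum)
  moreover have "avg (PiE e (\<lambda>i. V i \<times> V i)) (\<lambda>p. (\<Sum>T\<in>Pow (cubes e). q T p) ^ K)
      \<le> avg (PiE e (\<lambda>i. V i \<times> V i)) (\<lambda>p. real (card (Pow (cubes e))) ^ K * (\<Sum>T\<in>Pow (cubes e). q T p ^ K))"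
  proof (intro avg_mono sum_power_le)
    fix p T assume p: "p \<in> PiE e (\<lambda>i. V i \<times> V i)"
    have "cpt e ((\<lambda>i. fst (p i))(j := y0)) ((\<lambda>i. snd (p i))(j := y1)) \<omega> \<in> VE V e"
      if "y0 \<in> V j" "y1 \<in> V j" for y0 y1 \<omega>
      using p that by (auto simp: cpt_def VE_def PiE_iff mem_Times_iff)
    then show "0 \<le> q T p" unfolding q_def
      by (intro avg_nonneg) (auto intro!: prod_nonneg \<nu>)
  qed (use finite_cubes[OF e(1)] in auto)
  moreover have "avg (PiE e (\<lambda>i. V i \<times> V i)) (\<lambda>p. q T p ^ K) = Q T" for T
  proof -
    have "cpt e ((\<lambda>i. fst (p i))(j := y0)) ((\<lambda>i. snd (p i))(j := y1)) \<omega> =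
        cpt e ((\<lambda>i\<in>e - {j}. fst ((\<lambda>i\<in>e - {j}. p i) i))(j := y0)) ((\<lambda>i\<in>e - {j}. snd ((\<lambda>i\<in>e - {j}. p i) i))(j := y1)) \<omega>"
      for p :: "'j \<Rightarrow> 'a \<times> 'a" and y0 y1 \<omega>
      unfolding cpt_def by (rule restrict_ext) auto
    then have "avg (PiE e (\<lambda>i. V i \<times> V i)) (\<lambda>p. q T p ^ K) = avg (PiE e (\<lambda>i. V i \<times> V i)) (\<lambda>p.
       (\<lambda>p. (\<lambda>x0 x1. (avg (V j \<times> V j) (\<lambda>(y0, y1). \<Prod>\<omega>\<in>cubes e.
         (if \<omega> \<in> T then \<nu> (cpt e (x0(j := y0)) (x1(j := y1)) \<omega>) else 1))) ^ K)
         (\<lambda>i\<in>e - {j}. fst (p i)) (\<lambda>i\<in>e - {j}. snd (p i))) (\<lambda>i\<in>e - {j}. p i))"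
      unfolding q_def by (simp only:)
    also have "\<dots> = avg (PiE (e - {j}) (\<lambda>i. V i \<times> V i)) (\<lambda>p. (\<lambda>x0 x1. (avg (V j \<times> V j) (\<lambda>(y0, y1). \<Prod>\<omega>\<in>cubes e.
         (if \<omega> \<in> T then \<nu> (cpt e (x0(j := y0)) (x1(j := y1)) \<omega>) else 1))) ^ K)
         (\<lambda>i\<in>e - {j}. fst (p i)) (\<lambda>i\<in>e - {j}. snd (p i)))"
      by (rule avg_PiE_map[where \<pi> = "\<lambda>i x. x"]) (use e V in auto)
    also have "\<dots> = Q T" unfolding Q_def VE_def by (rule avg_PiE_pair[symmetric])
    finally show ?thesis .
  qed
  ultimately show ?thesis by (simp add: avg_cmult avg_sum)
qed

text \<open>Condition (ii) averages over V_J; this brings it down to the coordinates of a single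
  edge.\<close>

lemma avg_cube_marginal:
  fixes V :: "'j \<Rightarrow> 'a set"
  assumes "finite J" "e \<subseteq> J" "\<And>i. i \<in> J \<Longrightarrow> finite (V i) \<and> V i \<noteq> {}"
  shows "avg (VE V J \<times> VE V J) (\<lambda>(x0, x1). h (cpt e x0 x1)) = avg (VE V e \<times> VE V e) (\<lambda>(x0, x1). h (cpt e x0 x1))"
proof -
  have *: "cpt e (\<lambda>i\<in>A. fst (p i)) (\<lambda>i\<in>A. snd (p i)) = cpt e (\<lambda>i. fst (p i)) (\<lambda>i. snd (p i))" if "e \<subseteq> A"
    for A and p :: "'j \<Rightarrow> 'a \<times> 'a"
    using that by (auto simp: cpt_def restrict_def fun_eq_iff)
  have **: "cpt e (\<lambda>i. fst ((\<lambda>i\<in>e. p i) i)) (\<lambda>i. snd ((\<lambda>i\<in>e. p i) i)) = cpt e (\<lambda>i. fst (p i)) (\<lambda>i. snd (p i))"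
    for p :: "'j \<Rightarrow> 'a \<times> 'a"
    by (auto simp: cpt_def restrict_def fun_eq_iff)
  have "avg (PiE J (\<lambda>i. V i \<times> V i)) (\<lambda>p. (\<lambda>p. h (cpt e (\<lambda>i. fst (p i)) (\<lambda>i. snd (p i)))) (\<lambda>i\<in>e. p i))
      = avg (PiE e (\<lambda>i. V i \<times> V i)) (\<lambda>p. h (cpt e (\<lambda>i. fst (p i)) (\<lambda>i. snd (p i))))"
    by (rule avg_PiE_map[where \<pi> = "\<lambda>i x. x"]) (use assms in auto)
  then show ?thesis
    by (simp only: VE_def avg_PiE_pair[where h = "\<lambda>x0 x1. h (cpt e x0 x1)"] *[OF assms(2)] *[OF subset_refl] **)
qed

section \<open>The structure theorem\<close>

text \<open>At stage N the largest \<open>k \<le> N\<close> whose tolerance \<open>1 / k\<close> is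
  attained is taken. Every fixed positive \<open>m\<close> is eventually a candidate, so this
  \<open>k\<close> tends to infinity.\<close>

lemma diagonal_rate:
  fixes P :: "nat \<Rightarrow> real \<Rightarrow> bool"
  assumes "\<And>\<delta>. 0 < \<delta> \<Longrightarrow> \<delta> \<le> 1 \<Longrightarrow> \<forall>\<^sub>F N in sequentially. P N \<delta>"
  shows "\<exists>c. c \<longlonglongrightarrow> 0 \<and> (\<forall>\<^sub>F N in sequentially. P N (c N))"
proof -
  define Q where "Q N k \<longleftrightarrow> k \<le> N \<and> (k = 0 \<or> P N (1 / real k))" for N k
  define g where "g N = (GREATEST k. Q N k)" for N
  have Qg: "Q N (g N)" for N
    unfolding g_def by (rule GreatestI_nat[of "Q N" 0 N]) (auto simp: Q_def)
  have ge: "\<forall>\<^sub>F N in sequentially. m \<le> g N" if "1 \<le> m" for m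
  proof -
    have "\<forall>\<^sub>F N in sequentially. P N (1 / real m)" using that by (intro assms) auto
    then show ?thesis using eventually_ge_at_top[of m]
    proof eventually_elim
      case (elim N)
      then have "Q N m" by (simp add: Q_def)
      then show ?case unfolding g_def by (intro Greatest_le_nat[of "Q N" m N]) (auto simp: Q_def)
    qed
  qed
  have "filterlim g at_top sequentially"
    unfolding filterlim_at_top
  proof
    fix m show "\<forall>\<^sub>F N in sequentially. m \<le> g N" using ge[of "max 1 m"] by (auto elim: eventually_mono)
  qed
  then have "(\<lambda>N. 1 / real (g N)) \<longlonglongrightarrow> 0"
    using filterlim_compose[OF lim_1_over_n] by (auto simp: o_def)
  moreover have "\<forall>\<^sub>F N in sequentially. P N (1 / real (g N))"
    using ge[OF order.refl] by (rule eventually_mono) (metis Q_def Qg not_one_le_zero)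
  ultimately show ?thesis by blast
qed

lemma abs_Dop_le:
  assumes "x \<in> VE V e" "\<And>y. y \<in> VE V e \<Longrightarrow> \<bar>F y\<bar> \<le> w y"
  shows "\<bar>Dop V e F x\<bar> \<le> Dop V e w x"
  unfolding Dop_def
proof (rule avg_abs_mono)
  fix y assume "y \<in> VE V e"
  then show "\<bar>\<Prod>\<omega>\<in>cubes e - {zero_cube e}. F (cpt e x y \<omega>)\<bar> \<le> (\<Prod>\<omega>\<in>cubes e - {zero_cube e}. w (cpt e x y \<omega>))"
    unfolding abs_prod using assms by (intro prod_mono) (auto simp: cpt_in)
qed

lemma Dop_divide:
  "Dop V e (\<lambda>y. F y / c) x = Dop V e F x / c ^ card (cubes e - {zero_cube e})"
  by (simp add: Dop_def prod_dividef avg_def sum_divide_distrib[symmetric])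

text \<open>The zero vertex of the cube returns the first point, so \<open>F\<close> is precisely
  the factor that \<open>Dop\<close> omits.\<close>

lemma avg_mult_Dop:
  assumes "finite e"
  shows "avg (VE V e) (\<lambda>x. F x * Dop V e F x)
    = avg (VE V e \<times> VE V e) (\<lambda>(x0, x1). \<Prod>\<omega>\<in>cubes e. F (cpt e x0 x1 \<omega>))"
proof -
  have z: "zero_cube e \<in> cubes e" by (auto simp: cubes_def zero_cube_def)
  have "cpt e x y (zero_cube e) = x" if "x \<in> VE V e" for x y
    using that by (auto simp: cpt_def zero_cube_def VE_def PiE_iff extensional_def restrict_def fun_eq_iff)
  then show ?thesis
    by (simp add: avg_Times Dop_def avg_cmult[symmetric] prod.remove[OF finite_cubes[OF assms] z] cong: avg_cong)
qed

text \<open>Expanding \<open>\<nu> - 1\<close> over the cube gives signed terms whose averages all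
  tend to 1 by condition (ii); the signs add up to a positive power of 1 - 1.\<close>

lemma box_integral_shift_limit:
  fixes V :: "nat \<Rightarrow> 'j \<Rightarrow> 'a set"
  assumes "hypergraph_system J V d H" "pseudorandom J V H \<nu>" "e \<in> H"
  shows "(\<lambda>N. avg (VE (V N) e \<times> VE (V N) e) (\<lambda>(x0, x1). \<Prod>\<omega>\<in>cubes e. \<nu> N e (cpt e x0 x1 \<omega>) - 1)) \<longlonglongrightarrow> 0"
proof -
  have J: "finite J" "e \<subseteq> J" and V: "\<And>N i. i \<in> J \<Longrightarrow> finite (V N i) \<and> V N i \<noteq> {}" and HJ: "H \<subseteq> Pow J"
    using assms(1,3) by (auto simp: hypergraph_system_def)
  have H: "finite H" by (rule finite_subset[OF HJ]) (use J in simp)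
  have e: "finite e" using J finite_subset by blast
  note fc = finite_cubes[OF e]
  let ?a = "\<lambda>T N. avg (VE (V N) e \<times> VE (V N) e) (\<lambda>(x0, x1). \<Prod>\<omega>\<in>cubes e. if \<omega> \<in> T then \<nu> N e (cpt e x0 x1 \<omega>) else 1)"
  have lim: "?a T \<longlonglongrightarrow> 1" for T
  proof -
    \<comment> \<open>Exponents supported on the single edge \<open>e\<close>, so that the factors
      of all other edges are 1.\<close>
    define n where "n e' \<omega> \<longleftrightarrow> e' = e \<and> \<omega> \<in> T" for e' \<omega>
    have "(\<Prod>e'\<in>H. \<Prod>\<omega>\<in>cubes e'. (if n e' \<omega> then \<nu> N e' (cpt e' x0 x1 \<omega>) else 1))
      = (\<Prod>\<omega>\<in>cubes e. if \<omega> \<in> T then \<nu> N e (cpt e x0 x1 \<omega>) else 1)" for N x0 x1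
    proof -
      have "(\<Prod>e'\<in>H. \<Prod>\<omega>\<in>cubes e'. (if n e' \<omega> then \<nu> N e' (cpt e' x0 x1 \<omega>) else 1))
        = (\<Prod>e'\<in>H. if e' = e then (\<Prod>\<omega>\<in>cubes e. if \<omega> \<in> T then \<nu> N e (cpt e x0 x1 \<omega>) else 1) else 1)"
        by (intro prod.cong refl) (auto simp: n_def intro!: prod.neutral)
      then show ?thesis using H assms(3) by simp
    qed
    moreover have "(\<lambda>N. avg (VE (V N) J \<times> VE (V N) J) (\<lambda>(x0, x1). \<Prod>e\<in>H. \<Prod>\<omega>\<in>cubes e.
               (if n e \<omega> then \<nu> N e (cpt e x0 x1 \<omega>) else 1))) \<longlonglongrightarrow> 1"
      using assms(2) unfolding pseudorandom_def by blast
    ultimately have "(\<lambda>N. avg (VE (V N) J \<times> VE (V N) J) (\<lambda>(x0, x1).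
        \<Prod>\<omega>\<in>cubes e. if \<omega> \<in> T then \<nu> N e (cpt e x0 x1 \<omega>) else 1)) \<longlonglongrightarrow> 1"
      by (simp only:)
    moreover have "avg (VE (V N) J \<times> VE (V N) J) (\<lambda>(x0, x1).
        \<Prod>\<omega>\<in>cubes e. if \<omega> \<in> T then \<nu> N e (cpt e x0 x1 \<omega>) else 1) = ?a T N" for N
      by (rule avg_cube_marginal[OF J V, where h = "\<lambda>c. \<Prod>\<omega>\<in>cubes e. if \<omega> \<in> T then \<nu> N e (c \<omega>) else 1"])
    ultimately show ?thesis by (simp only:)
  qed
  have "(\<lambda>N. \<Sum>T\<in>Pow (cubes e). (- 1) ^ card (cubes e - T) * ?a T N)
      \<longlonglongrightarrow> (\<Sum>T\<in>Pow (cubes e). (- 1) ^ card (cubes e - T) * 1)"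
    by (intro tendsto_sum tendsto_mult tendsto_const lim)
  moreover have "(\<Sum>T\<in>Pow (cubes e). (- 1) ^ card (cubes e - T) * 1) = (0::real)"
  proof -
    have "zero_cube e \<in> cubes e" by (auto simp: cubes_def zero_cube_def)
    then have "0 < card (cubes e)" using fc by (auto simp: card_gt_0_iff)
    then show ?thesis using prod_add_one[OF fc, of "\<lambda>_. 1" "- 1"] by (simp add: power_0_left)
  qed
  moreover have "avg (VE (V N) e \<times> VE (V N) e) (\<lambda>(x0, x1). \<Prod>\<omega>\<in>cubes e. \<nu> N e (cpt e x0 x1 \<omega>) - 1)
      = (\<Sum>T\<in>Pow (cubes e). (- 1) ^ card (cubes e - T) * ?a T N)" for N
    using prod_add_one[OF fc, of _ "- 1"] by (simp add: split_def avg_sum avg_cmult)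
  ultimately show ?thesis by simp
qed

lemma fibre_box_moments_bounded:
  fixes V :: "nat \<Rightarrow> 'j \<Rightarrow> 'a set" and K :: nat
  assumes "hypergraph_system J V d H" "system_of_measures V H \<nu>" "pseudorandom J V H \<nu>" "e \<in> H"
  shows "\<exists>M\<ge>0. \<forall>N. \<forall>j\<in>e. avg (PiE e (\<lambda>i. V N i \<times> V N i)) (\<lambda>p. fibre_box (V N) e j (\<lambda>x. \<nu> N e x + 1) p ^ K) \<le> M"
proof -
  have J: "finite J" "e \<subseteq> J" and V: "\<And>N i. i \<in> J \<Longrightarrow> finite (V N i) \<and> V N i \<noteq> {}"
    using assms(1,4) by (auto simp: hypergraph_system_def)
  have e: "finite e" using J finite_subset by blast
  let ?Q = "\<lambda>N j T. avg (VE (V N) (e - {j}) \<times> VE (V N) (e - {j}))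
           (\<lambda>(x0, x1). (avg (V N j \<times> V N j)
              (\<lambda>(y0, y1). \<Prod>\<omega>\<in>cubes e.
                 (if \<omega> \<in> T then \<nu> N e (cpt e (x0(j := y0)) (x1(j := y1)) \<omega>) else 1))) ^ K)"
  have "\<forall>j\<in>e. \<exists>C. \<forall>N. \<bar>?Q N j T\<bar> \<le> C" for T
  proof
    fix j assume "j \<in> e"
    then show "\<exists>C. \<forall>N. \<bar>?Q N j T\<bar> \<le> C"
      using assms(3,4) unfolding pseudorandom_def
      by (elim conjE) (drule bspec, assumption, drule bspec, assumption, drule spec[of _ "\<lambda>\<omega>. \<omega> \<in> T"], blast)
  qed
  then have "\<exists>C. \<forall>j\<in>e. \<forall>N. \<bar>?Q N j T\<bar> \<le> C j" for T
    by (intro bchoice)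
  then have "\<exists>C. \<forall>T. \<forall>j\<in>e. \<forall>N. \<bar>?Q N j T\<bar> \<le> C T j" by (intro choice allI)
  then obtain C where C: "\<forall>T. \<forall>j\<in>e. \<forall>N. \<bar>?Q N j T\<bar> \<le> C T j" by (elim exE)
  define m where "m = real (card (Pow (cubes e))) ^ K"
  define M where "M = (\<Sum>j\<in>e. m * (\<Sum>T\<in>Pow (cubes e). \<bar>C T j\<bar>))"
  have m: "0 \<le> m" by (simp add: m_def)
  have "avg (PiE e (\<lambda>i. V N i \<times> V N i)) (\<lambda>p. fibre_box (V N) e j (\<lambda>x. \<nu> N e x + 1) p ^ K) \<le> M" if j: "j \<in> e" for N j
  proof -
    have "avg (PiE e (\<lambda>i. V N i \<times> V N i)) (\<lambda>p. fibre_box (V N) e j (\<lambda>x. \<nu> N e x + 1) p ^ K)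
      \<le> m * (\<Sum>T\<in>Pow (cubes e). ?Q N j T)"
      unfolding m_def using assms(2,4) J V
      by (intro avg_fibre_box_le e j) (auto simp: system_of_measures_def)
    also have "\<dots> \<le> m * (\<Sum>T\<in>Pow (cubes e). \<bar>C T j\<bar>)"
    proof (intro mult_left_mono m sum_mono)
      fix T show "?Q N j T \<le> \<bar>C T j\<bar>" using C[rule_format, OF j, of N T] by linarith
    qed
    also have "\<dots> \<le> M" unfolding M_def using j e m by (intro member_le_sum) (auto intro!: mult_nonneg_nonneg sum_nonneg)
    finally show ?thesis .
  qed
  moreover have "0 \<le> M" unfolding M_def using m by (intro sum_nonneg mult_nonneg_nonneg) auto
  ultimately show ?thesis by blast
qed

text \<open>The functions \<open>F k\<close> enter only through the moment bound \<open>M\<close>;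
  what remains is the box integral of \<open>\<nu> - 1\<close>, which is why the estimate is uniform
  in them.\<close>

lemma dual_products_orthogonal:
  fixes V :: "nat \<Rightarrow> 'j \<Rightarrow> 'a set" and K :: nat
  assumes "hypergraph_system J V d H" "system_of_measures V H \<nu>" "pseudorandom J V H \<nu>" "e \<in> H" "0 < \<kappa>"
  shows "\<forall>\<^sub>F N in sequentially. \<forall>F. (\<forall>k<K. \<forall>x\<in>VE (V N) e. \<bar>F k x\<bar> \<le> \<nu> N e x + 1) \<longrightarrow>
    \<bar>avg (VE (V N) e) (\<lambda>x. (\<nu> N e x - 1) * (\<Prod>k<K. Dop (V N) e (F k) x))\<bar> \<le> \<kappa>"
proof -
  have J: "finite J" "e \<subseteq> J" and V: "\<And>N i. i \<in> J \<Longrightarrow> finite (V N i) \<and> V N i \<noteq> {}"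
    using assms(1,4) by (auto simp: hypergraph_system_def)
  have e: "finite e" using J finite_subset by blast
  obtain M where M: "0 \<le> M" "\<And>N j. j \<in> e \<Longrightarrow>
      avg (PiE e (\<lambda>i. V N i \<times> V N i)) (\<lambda>p. fibre_box (V N) e j (\<lambda>x. \<nu> N e x + 1) p ^ K) \<le> M"
    using fibre_box_moments_bounded[OF assms(1-4)] by blast
  define D where "D = (1 + K * M) ^ (2 ^ card e - 1)"
  have D: "0 < D" unfolding D_def using M by (intro zero_less_power add_pos_nonneg) auto
  have "0 < \<kappa> ^ 2 ^ card e / D" using assms(5) D by simp
  from tendstoD[OF box_integral_shift_limit[OF assms(1,3,4)] this] show ?thesis
  proof eventually_elim
    case (elim N)
    show ?case
    proof (intro allI impI)
      fix F assume F: "\<forall>k<K. \<forall>x\<in>VE (V N) e. \<bar>F k x\<bar> \<le> \<nu> N e x + 1"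
      let ?I = "avg (VE (V N) e) (\<lambda>x. (\<nu> N e x - 1) * (\<Prod>k<K. Dop (V N) e (F k) x))"
      have "\<bar>?I\<bar> ^ 2 ^ card e \<le> D * \<bar>avg (VE (V N) e \<times> VE (V N) e) (\<lambda>(x0, x1). \<Prod>\<omega>\<in>cubes e. \<nu> N e (cpt e x0 x1 \<omega>) - 1)\<bar>"
        unfolding D_def
        by (rule avg_dual_prod_le[where w = "\<lambda>x. \<nu> N e x + 1"]) (use e J V F M in auto)
      also have "\<dots> \<le> D * (\<kappa> ^ 2 ^ card e / D)"
        using elim D by (intro mult_left_mono) (auto simp: dist_real_def)
      also have "\<dots> = \<kappa> ^ 2 ^ card e" using D by simp
      finally show "\<bar>?I\<bar> \<le> \<kappa>" using assms(5) by (subst (asm) power_mono_iff) auto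
    qed
  qed
qed

text \<open>The residual vanishes on the bad set and lies between -2 and \<open>\<nu>\<close>
  elsewhere; half of it therefore has an admissible dual function.\<close>

lemma abs_residual_le:
  assumes "\<And>y. y \<in> X \<Longrightarrow> 0 \<le> f y" "\<And>y. y \<in> X \<Longrightarrow> f y \<le> \<nu> y" "\<delta> \<le> 1" "x \<in> X"
  shows "\<bar>residual X \<phi> \<nu> \<delta> f x\<bar> \<le> 2 * (\<nu> x + 1)"
proof (cases "x \<in> bad_set X \<phi> \<nu> \<delta>")
  case True
  then show ?thesis using assms order_trans[OF assms(1,2)] by (simp add: residual_def)
next
  case False
  then have "class_avg X \<phi> f x \<le> 2" "0 \<le> class_avg X \<phi> f x"
    using assms by (auto intro: class_avg_le_2[of X f \<nu> x \<phi> \<delta>] class_avg_nonneg)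
  then show ?thesis using False assms(1,2)[OF assms(4)] by (simp add: residual_def abs_le_iff)
qed

text \<open>\<open>ln\<close> is extended to negative arguments as an even function, so
  \<open>powr\<close> sees only the absolute value of its base. A bound on the absolute value of the
  box integral thus suffices.\<close>

lemma box_norm_eq_abs:
  "box_norm V e g = \<bar>avg (VE V e \<times> VE V e) (\<lambda>(x0, x1). \<Prod>\<omega>\<in>cubes e. g (cpt e x0 x1 \<omega>))\<bar> powr (1 / 2 ^ card e)"
  by (simp add: box_norm_def powr_def abs_if ln_minus)

lemma structure_theorem_rate:
  fixes V :: "nat \<Rightarrow> 'j \<Rightarrow> 'a set"
  assumes sys: "hypergraph_system J V d H" "system_of_measures V H \<nu>" "pseudorandom J V H \<nu>" "e \<in> H"
    and \<epsilon>: "0 < \<epsilon>" "\<epsilon> < 1" and \<delta>: "0 < \<delta>" "\<delta> \<le> 1"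
  shows "\<forall>\<^sub>F N in sequentially. \<forall>f :: ('j \<Rightarrow> 'a) \<Rightarrow> real.
         (\<forall>x\<in>VE (V N) e. 0 \<le> f x \<and> f x \<le> \<nu> N e x) \<longrightarrow>
         (\<exists>B \<Omega>. sigma_algebra (VE (V N) e) B \<and> \<Omega> \<in> B \<and>
            \<bar>avg (VE (V N) e) (\<lambda>x. indicator \<Omega> x * \<nu> N e x)\<bar> \<le> \<delta> \<and>
            (\<forall>x\<in>VE (V N) e - \<Omega>. \<bar>cond_exp (VE (V N) e) B (\<nu> N e) x - 1\<bar> \<le> \<delta>) \<and>
            box_norm (V N) e (\<lambda>x. (1 - indicator \<Omega> x) * (f x - cond_exp (VE (V N) e) B f x))
              \<le> \<epsilon> powr (1 / 2 ^ card J))"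
proof -
  have J: "finite J" "e \<subseteq> J" and V: "\<And>N i. i \<in> J \<Longrightarrow> finite (V N i) \<and> V N i \<noteq> {}"
    using sys(1,4) by (auto simp: hypergraph_system_def)
  have e: "finite e" using J finite_subset by blast
  have \<nu>: "0 \<le> \<nu> N e x" if "x \<in> VE (V N) e" for N x
    using sys(2,4) that by (auto simp: system_of_measures_def)
  define \<D> where "\<D> N = {Dop (V N) e F | F. \<forall>x\<in>VE (V N) e. \<bar>F x\<bar> \<le> \<nu> N e x + 1}" for N
  obtain C0 where C0: "\<And>N x. x \<in> VE (V N) e \<Longrightarrow> \<bar>Dop (V N) e (\<lambda>y. \<nu> N e y + 1) x\<bar> \<le> C0"
    using bspec[OF conjunct1[OF sys(3)[unfolded pseudorandom_def]] sys(4)] by auto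
  interpret dual_system "\<lambda>N. VE (V N) e" "\<lambda>N. \<nu> N e" \<D> "max 1 C0"
  proof
    show "finite (VE (V N) e)" "VE (V N) e \<noteq> {}" for N
      using finite_VE[OF e, of "V N"] V J by auto
  next
    fix G N x assume "G \<in> \<D> N" and x: "x \<in> VE (V N) e"
    then obtain F where "G = Dop (V N) e F" "\<forall>x\<in>VE (V N) e. \<bar>F x\<bar> \<le> \<nu> N e x + 1" by (auto simp: \<D>_def)
    then have "\<bar>G x\<bar> \<le> Dop (V N) e (\<lambda>y. \<nu> N e y + 1) x" using abs_Dop_le[OF x] by simp
    then show "\<bar>G x\<bar> \<le> max 1 C0" using C0[OF x] by simp
  next
    fix \<kappa> :: real and K assume "0 < \<kappa>"
    from dual_products_orthogonal[OF sys this, of K]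
    show "\<forall>\<^sub>F N in sequentially. \<forall>Gs. length Gs = K \<and> set Gs \<subseteq> \<D> N \<longrightarrow>
      \<bar>avg (VE (V N) e) (\<lambda>x. (\<nu> N e x - 1) * (\<Prod>G\<leftarrow>Gs. G x))\<bar> \<le> \<kappa>"
    proof eventually_elim
      case (elim N)
      show ?case
      proof (intro allI impI)
        fix Gs assume Gs: "length Gs = K \<and> set Gs \<subseteq> \<D> N"
        then have "\<forall>k\<in>{..<K}. \<exists>F. Gs ! k = Dop (V N) e F \<and> (\<forall>x\<in>VE (V N) e. \<bar>F x\<bar> \<le> \<nu> N e x + 1)"
          using nth_mem by (fastforce simp: \<D>_def)
        then obtain F where F: "\<And>k. k < K \<Longrightarrow> Gs ! k = Dop (V N) e (F k) \<and> (\<forall>x\<in>VE (V N) e. \<bar>F k x\<bar> \<le> \<nu> N e x + 1)"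
          by (auto dest!: bchoice)
        have "(\<Prod>G\<leftarrow>Gs. G x) = (\<Prod>k<K. Dop (V N) e (F k) x)" for x
          using Gs F by (auto simp: prod.list_conv_set_nth atLeast0LessThan intro!: prod.cong)
        then show "\<bar>avg (VE (V N) e) (\<lambda>x. (\<nu> N e x - 1) * (\<Prod>G\<leftarrow>Gs. G x))\<bar> \<le> \<kappa>"
          using elim F by simp
      qed
    qed
  qed (use \<nu> in auto)
  define n where "n = card (cubes e - {zero_cube e})"
  \<comment> \<open>Halving the residual divides its dual function by \<open>2 ^ n\<close>, since
    \<open>Dop\<close> is homogeneous of degree \<open>n\<close>; this is compensated here.\<close>
  define \<epsilon>' where "\<epsilon>' = \<epsilon> / 2 ^ n"
  have \<epsilon>': "0 < \<epsilon>'" "\<epsilon>' \<le> 1" using \<epsilon> by (auto simp: \<epsilon>'_def divide_le_eq intro: order_trans[OF less_imp_le])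
  from weak_regularity[OF \<epsilon>' \<delta>] show ?thesis
  proof eventually_elim
    case (elim N)
    let ?X = "VE (V N) e"
    show ?case
    proof (intro allI impI)
      fix f assume f: "\<forall>x\<in>?X. 0 \<le> f x \<and> f x \<le> \<nu> N e x"
      then obtain \<phi> :: "('j \<Rightarrow> 'a) \<Rightarrow> int list" where
        bad: "avg ?X (\<lambda>x. indicator (bad_set ?X \<phi> (\<nu> N e) \<delta>) x * \<nu> N e x) \<le> \<delta>" and
        corr: "\<And>G. G \<in> \<D> N \<Longrightarrow> \<bar>avg ?X (\<lambda>x. residual ?X \<phi> (\<nu> N e) \<delta> f x * G x)\<bar> \<le> \<epsilon>'"
        using elim by blast
      define \<Omega> where "\<Omega> = bad_set ?X \<phi> (\<nu> N e) \<delta>"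
      define B where "B = saturated_sets ?X \<phi>"
      define R where "R = residual ?X \<phi> (\<nu> N e) \<delta> f"
      let ?box = "\<lambda>g. avg (?X \<times> ?X) (\<lambda>(x0, x1). \<Prod>\<omega>\<in>cubes e. g (cpt e x0 x1 \<omega>))"
      have "\<bar>R x / 2\<bar> \<le> \<nu> N e x + 1" if "x \<in> ?X" for x
        using abs_residual_le[of ?X f "\<nu> N e" \<delta> x \<phi>] f \<delta> that by (auto simp: R_def)
      then have "Dop (V N) e (\<lambda>x. R x / 2) \<in> \<D> N" by (auto simp: \<D>_def)
      from corr[OF this] have "\<bar>avg ?X (\<lambda>x. R x * Dop (V N) e R x) / 2 ^ n\<bar> \<le> \<epsilon>'"
        by (simp add: R_def[symmetric] Dop_divide n_def avg_def sum_divide_distrib[symmetric] mult.commute)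
      then have "\<bar>?box R\<bar> \<le> \<epsilon>"
        by (simp add: avg_mult_Dop[OF e] \<epsilon>'_def abs_divide divide_le_cancel)
      moreover have "?box (\<lambda>x. (1 - indicator \<Omega> x) * (f x - cond_exp ?X B f x)) = ?box R"
        by (intro avg_cong) (auto intro!: prod.cong
            simp: R_def residual_def \<Omega>_def B_def cond_exp_saturated_sets cpt_in)
      ultimately have "box_norm (V N) e (\<lambda>x. (1 - indicator \<Omega> x) * (f x - cond_exp ?X B f x)) \<le> \<epsilon> powr (1 / 2 ^ card e)"
        unfolding box_norm_eq_abs by (intro powr_mono2) auto
      \<comment> \<open>For \<open>\<epsilon> < 1\<close> the smaller exponent gives the larger
        power.\<close>
      also have "\<dots> \<le> \<epsilon> powr (1 / 2 ^ card J)"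
        using \<epsilon> card_mono[OF J] by (intro powr_mono') (auto intro!: divide_left_mono power_increasing)
      finally have "box_norm (V N) e (\<lambda>x. (1 - indicator \<Omega> x) * (f x - cond_exp ?X B f x)) \<le> \<epsilon> powr (1 / 2 ^ card J)" .
      moreover have "\<bar>avg ?X (\<lambda>x. indicator \<Omega> x * \<nu> N e x)\<bar> \<le> \<delta>"
        using bad \<nu> avg_nonneg[of ?X "\<lambda>x. indicator \<Omega> x * \<nu> N e x"] by (simp add: \<Omega>_def)
      moreover have "\<bar>cond_exp ?X B (\<nu> N e) x - 1\<bar> \<le> \<delta>" if "x \<in> ?X - \<Omega>" for x
        using that by (auto simp: B_def \<Omega>_def bad_set_def cond_exp_saturated_sets)
      moreover have "sigma_algebra ?X B" "\<Omega> \<in> B"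
        by (simp_all add: B_def \<Omega>_def sigma_algebra_saturated_sets bad_set_saturated)
      ultimately show "\<exists>B \<Omega>. sigma_algebra ?X B \<and> \<Omega> \<in> B \<and>
            \<bar>avg ?X (\<lambda>x. indicator \<Omega> x * \<nu> N e x)\<bar> \<le> \<delta> \<and>
            (\<forall>x\<in>?X - \<Omega>. \<bar>cond_exp ?X B (\<nu> N e) x - 1\<bar> \<le> \<delta>) \<and>
            box_norm (V N) e (\<lambda>x. (1 - indicator \<Omega> x) * (f x - cond_exp ?X B f x)) \<le> \<epsilon> powr (1 / 2 ^ card J)"
        by blast
    qed
  qed
qed

theorem mainTheorem10:
  fixes J :: "'j set" and V :: "nat \<Rightarrow> 'j \<Rightarrow> 'a set" and d :: nat and H :: "'j set set"
    and \<nu> :: "nat \<Rightarrow> 'j set \<Rightarrow> ('j \<Rightarrow> 'a) \<Rightarrow> real" and e :: "'j set"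
  assumes "hypergraph_system J V d H"
    and "system_of_measures V H \<nu>"
    and "pseudorandom J V H \<nu>"
    and "e \<in> H"
  shows "\<exists>\<epsilon>0 > 0. \<exists>c :: real \<Rightarrow> nat \<Rightarrow> real. (\<forall>\<epsilon>. c \<epsilon> \<longlonglongrightarrow> 0) \<and>
    (\<forall>\<epsilon>. 0 < \<epsilon> \<and> \<epsilon> < 1 \<and> \<epsilon> < \<epsilon>0 \<longrightarrow>
      (\<exists>N0. \<forall>N \<ge> N0. \<forall>f :: ('j \<Rightarrow> 'a) \<Rightarrow> real.
         (\<forall>x\<in>VE (V N) e. 0 \<le> f x \<and> f x \<le> \<nu> N e x) \<longrightarrow>
         (\<exists>B \<Omega>. sigma_algebra (VE (V N) e) B \<and> \<Omega> \<in> B \<and>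
            \<bar>avg (VE (V N) e) (\<lambda>x. indicator \<Omega> x * \<nu> N e x)\<bar> \<le> c \<epsilon> N \<and>
            (\<forall>x\<in>VE (V N) e - \<Omega>. \<bar>cond_exp (VE (V N) e) B (\<nu> N e) x - 1\<bar> \<le> c \<epsilon> N) \<and>
            box_norm (V N) e (\<lambda>x. (1 - indicator \<Omega> x) * (f x - cond_exp (VE (V N) e) B f x))
              \<le> \<epsilon> powr (1 / 2 ^ card J))))"
proof -
  \<comment> \<open>\<open>f\<close> is quantified inside \<open>P\<close>, so the rate produced
    below does not depend on it.\<close>
  define P where "P \<epsilon> N \<delta> \<longleftrightarrow> (\<forall>f :: ('j \<Rightarrow> 'a) \<Rightarrow> real.
         (\<forall>x\<in>VE (V N) e. 0 \<le> f x \<and> f x \<le> \<nu> N e x) \<longrightarrow>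
         (\<exists>B \<Omega>. sigma_algebra (VE (V N) e) B \<and> \<Omega> \<in> B \<and>
            \<bar>avg (VE (V N) e) (\<lambda>x. indicator \<Omega> x * \<nu> N e x)\<bar> \<le> \<delta> \<and>
            (\<forall>x\<in>VE (V N) e - \<Omega>. \<bar>cond_exp (VE (V N) e) B (\<nu> N e) x - 1\<bar> \<le> \<delta>) \<and>
            box_norm (V N) e (\<lambda>x. (1 - indicator \<Omega> x) * (f x - cond_exp (VE (V N) e) B f x))
              \<le> \<epsilon> powr (1 / 2 ^ card J)))" for \<epsilon> N \<delta>
  have "\<exists>c. c \<longlonglongrightarrow> 0 \<and> (0 < \<epsilon> \<and> \<epsilon> < 1 \<longrightarrow> (\<forall>\<^sub>F N in sequentially. P \<epsilon> N (c N)))" for \<epsilon>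
  proof (cases "0 < \<epsilon> \<and> \<epsilon> < 1")
    case True
    then have "\<forall>\<^sub>F N in sequentially. P \<epsilon> N \<delta>" if "0 < \<delta>" "\<delta> \<le> 1" for \<delta>
      unfolding P_def using structure_theorem_rate[OF assms _ _ that] by blast
    then show ?thesis using diagonal_rate[of "P \<epsilon>"] by blast
  next
    \<comment> \<open>The rate is a function of every real \<open>\<epsilon>\<close>; outside the
      interval (0, 1) only its convergence is asked.\<close>
    case False
    then show ?thesis by (intro exI[of _ "\<lambda>_. 0"]) auto
  qed
  then obtain c where c: "\<And>\<epsilon>. c \<epsilon> \<longlonglongrightarrow> 0"
    "\<And>\<epsilon>. 0 < \<epsilon> \<Longrightarrow> \<epsilon> < 1 \<Longrightarrow> \<forall>\<^sub>F N in sequentially. P \<epsilon> N (c \<epsilon> N)" by metis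
  \<comment> \<open>Every \<open>\<epsilon>\<close> in (0, 1) is small enough, so the threshold
    \<open>\<epsilon>0\<close> is 1.\<close>
  have "\<exists>N0. \<forall>N\<ge>N0. P \<epsilon> N (c \<epsilon> N)" if "0 < \<epsilon> \<and> \<epsilon> < 1 \<and> \<epsilon> < 1" for \<epsilon>
    using c(2)[of \<epsilon>] that by (simp add: eventually_sequentially)
  then show ?thesis
    using c(1) unfolding P_def by (intro exI[of _ "1 :: real"] exI[of _ c] conjI allI zero_less_one impI) blast+
qed

end
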